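(* Let $M,\bar M$ be smooth manifolds of the same dimension, $N\subset M\times\bar M$ open, and $c\in C^4(N)\cap C(M\times\bar M)$ a cost which is bi-twisted and non-degenerate on $N$. Suppose the pseudo-Riemannian metric $h$ induced by $c$ on $N$ is non-negatively cross-curved. If for some $h$-geodesic $\sigma:t\in[0,1]\mapsto(x,\bar x(t))\in N$ the set $V_\sigma:=\bigcap_{0\le t\le1}V(x,\bar x(t))$ is dense in $M$, then for each $y\in M$ the function $f_t(y):=-c(y,\bar x(t))+c(x,\bar x(t))$ satisfies $$f_t(y)\le(1-t)f_0(y)+tf_1(y)\qquad\text{for }0\le t\le1.$$
   Context: $D$, $\bar D$ denote differentials along $M$ and $\bar M$. Visible sets: $N(\bar x)=\{x\in M:(x,\bar x)\in N\}$, $\bar N(x)=\{\bar x\in\bar M:(x,\bar x)\in N\}$. The cost is bi-twisted (A1) if for all $(x,\bar x)\in N$ the maps $Dc(x,\cdot):\bar N(x)\to T_x^*M$ and $\bar Dc(\cdot,\bar x):N(\bar x)\to T^*_{\bar x}\bar M$ are injective; it is non-degenerate (A2) if $D\bar Dc$, i.e. the matrix $(c_{i\bar j})$ of mixed second derivatives in local coordinates $x^i$ on $M$ and $x^{\bar j}$ on $\bar M$, is invertible at every point of $N$. The induced pseudo-Riemannian metric on $TN=TM\oplus T\bar M$ is $$h=\begin{pmatrix}0&-\frac12\bar DDc\\-\frac12 D\bar Dc&0\end{pmatrix},\qquad\text{i.e. } h(p\oplus\bar p,p\oplus\bar p)=-c_{i\bar j}\,p^i\bar p^{\bar j}.$$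 The cross-curvature is $\operatorname{cross}_{(x,\bar x)}(p,\bar p)=R_h((p\oplus0)\wedge(0\oplus\bar p),(p\oplus0)\wedge(0\oplus\bar p))$, with $R_h$ the Riemann curvature operator of $h$, with sign and normalization such that $$\operatorname{cross}_{(x,\bar x)}(p,\bar p)=2\left(-c_{ij\bar k\bar l}+c_{ij\bar a}\,c^{\bar a b}\,c_{b\bar k\bar l}\right)p^ip^j\bar p^{\bar k}\bar p^{\bar l},$$ $(c^{\bar a b})$ being the inverse of $(c_{b\bar a})$. $(N,h)$ is non-negatively cross-curved if $\operatorname{cross}_{(x,\bar x)}(p,\bar p)\ge0$ for all $(x,\bar x)\in N$ and all $p\oplus\bar p\in T_{(x,\bar x)}N$. Geodesics are affinely parameterized geodesics of $h$; the submanifolds $\{x\}\times\bar N(x)$ and $N(\bar x)\times\{\bar x\}$ are totally geodesic. Illuminated set: for $(x,\bar x)\in N$, $V(x,\bar x)\subset M$ is the set of points $y\in N(\bar x)$ for which there is an $h$-geodesic from $(x,\bar x)$ to $(y,\bar x)$ in $N(\bar x)\times\{\bar x\}$. *)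

theory Defs
  imports "HOL-Analysis.Analysis"
begin

section \<open>Calculus in coordinates\<close>

definition partial_deriv :: "'m::finite \<Rightarrow> (real^'m \<Rightarrow> real) \<Rightarrow> real^'m \<Rightarrow> real" where
  "partial_deriv i f z = frechet_derivative f (at z) (axis i 1)"

text \<open>The class \<open>C^k\<close> on a set \<open>S\<close>; this is used for open \<open>S\<close> only.\<close>

primrec Ck_on :: "nat \<Rightarrow> (real^'m::finite) set \<Rightarrow> (real^'m \<Rightarrow> real) \<Rightarrow> bool" where
  "Ck_on 0 S f \<longleftrightarrow> continuous_on S f"
| "Ck_on (Suc k) S f \<longleftrightarrow>
     (\<forall>z\<in>S. f differentiable (at z)) \<and> (\<forall>i. Ck_on k S (partial_deriv i f))"

definition smooth_map_on :: "(real^'m::finite) set \<Rightarrow> (real^'m \<Rightarrow> real^'n::finite) \<Rightarrow> bool" where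
  "smooth_map_on S F \<longleftrightarrow> (\<forall>k i. Ck_on k S (\<lambda>z. F z $ i))"


section \<open>Smooth manifolds\<close>

text \<open>
  A manifold is a whole type, Hausdorff and second countable by its sort, with a smooth atlas whose
  charts are pairs of a domain and a coordinate map. Outside the domain the coordinate map is
  unspecified.
\<close>

type_synonym ('a, 'n) chart = "'a set \<times> ('a \<Rightarrow> real^'n)"

definition chart_inv :: "('a, 'n::finite) chart \<Rightarrow> real^'n \<Rightarrow> 'a" where
  "chart_inv \<phi> = inv_into (fst \<phi>) (snd \<phi>)"

definition is_chart :: "('a::topological_space, 'n::finite) chart \<Rightarrow> bool" where
  "is_chart \<phi> \<longleftrightarrow> open (fst \<phi>) \<and> open (snd \<phi> ` fst \<phi>) \<and>
     homeomorphism (fst \<phi>) (snd \<phi> ` fst \<phi>) (snd \<phi>) (chart_inv \<phi>)"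

definition smooth_atlas ::
  "('a::{t2_space,second_countable_topology}, 'n::finite) chart set \<Rightarrow> bool" where
  "smooth_atlas A \<longleftrightarrow>
     (\<forall>\<phi>\<in>A. is_chart \<phi>) \<and> (\<Union>\<phi>\<in>A. fst \<phi>) = UNIV \<and>
     (\<forall>\<phi>\<in>A. \<forall>\<psi>\<in>A. smooth_map_on (snd \<phi> ` (fst \<phi> \<inter> fst \<psi>)) (snd \<psi> \<circ> chart_inv \<phi>))"


section \<open>Pseudo-Riemannian geometry in coordinates\<close>

type_synonym 'm metric = "real^'m \<Rightarrow> real^'m^'m"

text \<open>\<open>christoffel g k i j\<close> is \<open>\<Gamma>\<^sup>k\<^sub>i\<^sub>j\<close> of the Levi-Civita connection.\<close>

definition christoffel :: "'m::finite metric \<Rightarrow> 'm \<Rightarrow> 'm \<Rightarrow> 'm \<Rightarrow> real^'m \<Rightarrow> real" where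
  "christoffel g k i j z = 1/2 * (\<Sum>l\<in>UNIV. matrix_inv (g z) $ k $ l *
     (partial_deriv i (\<lambda>w. g w $ j $ l) z + partial_deriv j (\<lambda>w. g w $ i $ l) z
      - partial_deriv l (\<lambda>w. g w $ i $ j) z))"

text \<open>\<open>riemann g l k i j\<close> is the \<open>l\<close>-th component of \<open>R(e\<^sub>i,e\<^sub>j)e\<^sub>k\<close>, where
  \<open>R(X,Y) = [\<nabla>\<^sub>X,\<nabla>\<^sub>Y] - \<nabla>\<^sub>[\<^sub>X\<^sub>,\<^sub>Y\<^sub>]\<close>.\<close>

definition riemann :: "'m::finite metric \<Rightarrow> 'm \<Rightarrow> 'm \<Rightarrow> 'm \<Rightarrow> 'm \<Rightarrow> real^'m \<Rightarrow> real" where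
  "riemann g l k i j z =
     partial_deriv i (christoffel g l j k) z - partial_deriv j (christoffel g l i k) z
     + (\<Sum>m\<in>UNIV. christoffel g l i m z * christoffel g m j k z
                 - christoffel g l j m z * christoffel g m i k z)"

definition wedge :: "real^'m::finite \<Rightarrow> real^'m \<Rightarrow> real^'m^'m" where
  "wedge u v = (\<chi> i j. u $ i * v $ j - v $ i * u $ j)"

text \<open>
  The curvature operator as a bilinear form on bivectors,
  \<open>\<Sum> \<langle>R(e\<^sub>i,e\<^sub>j)e\<^sub>l, e\<^sub>k\<rangle> \<alpha>\<^sup>i\<^sup>j \<beta>\<^sup>k\<^sup>l\<close>, so that its value at \<open>(u \<and> v, u \<and> v)\<close> is
  \<open>4 \<langle>R(u,v)v, u\<rangle>\<close>: non-negative on round spheres. For the metric of a cost below, this sign and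
  this factor 4 yield the cross-curvature
  \<open>2 (-c\<^sub>i\<^sub>j\<^sub>k\<^sub>l + c\<^sub>i\<^sub>j\<^sub>a c\<^sup>a\<^sup>b c\<^sub>b\<^sub>k\<^sub>l) p\<^sup>i p\<^sup>j q\<^sup>k q\<^sup>l\<close>, with \<open>i, j, b\<close> indices on the first factor and
  \<open>k, l, a\<close> on the second.
\<close>

definition curvature_operator ::
  "'m::finite metric \<Rightarrow> real^'m \<Rightarrow> real^'m^'m \<Rightarrow> real^'m^'m \<Rightarrow> real" where
  "curvature_operator g z \<alpha> \<beta> =
     (\<Sum>i\<in>UNIV. \<Sum>j\<in>UNIV. \<Sum>k\<in>UNIV. \<Sum>l\<in>UNIV.
        (\<Sum>m\<in>UNIV. g z $ m $ k * riemann g m l i j z) * \<alpha> $ i $ j * \<beta> $ k $ l)"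


section \<open>The cost in product coordinates\<close>

text \<open>\<open>p \<oplus> q\<close>: index \<open>Inl i\<close> belongs to the first factor, \<open>Inr j\<close> to the second.\<close>

definition dsum :: "real^'n::finite \<Rightarrow> real^'n \<Rightarrow> real^('n + 'n)" where
  "dsum p q = (\<chi> a. case a of Inl i \<Rightarrow> p $ i | Inr j \<Rightarrow> q $ j)"

definition pr1 :: "real^('n::finite + 'n) \<Rightarrow> real^'n" where
  "pr1 z = (\<chi> i. z $ Inl i)"

definition pr2 :: "real^('n::finite + 'n) \<Rightarrow> real^'n" where
  "pr2 z = (\<chi> j. z $ Inr j)"

definition coords ::
  "('a, 'n::finite) chart \<Rightarrow> ('b, 'n) chart \<Rightarrow> 'a \<times> 'b \<Rightarrow> real^('n + 'n)" where
  "coords \<phi> \<psi> P = dsum (snd \<phi> (fst P)) (snd \<psi> (snd P))"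

definition local_cost ::
  "('a \<times> 'b \<Rightarrow> real) \<Rightarrow> ('a, 'n::finite) chart \<Rightarrow> ('b, 'n) chart \<Rightarrow> real^('n + 'n) \<Rightarrow> real" where
  "local_cost c \<phi> \<psi> z = c (chart_inv \<phi> (pr1 z), chart_inv \<psi> (pr2 z))"

definition Ck_cost_on ::
  "nat \<Rightarrow> ('a, 'n::finite) chart set \<Rightarrow> ('b, 'n) chart set \<Rightarrow> ('a \<times> 'b) set
    \<Rightarrow> ('a \<times> 'b \<Rightarrow> real) \<Rightarrow> bool" where
  "Ck_cost_on k A B N c \<longleftrightarrow>
     (\<forall>\<phi>\<in>A. \<forall>\<psi>\<in>B. Ck_on k (coords \<phi> \<psi> ` (N \<inter> fst \<phi> \<times> fst \<psi>)) (local_cost c \<phi> \<psi>))"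

definition visible :: "('a \<times> 'b) set \<Rightarrow> 'b \<Rightarrow> 'a set" where
  "visible N xb = {x. (x, xb) \<in> N}"

definition visible_bar :: "('a \<times> 'b) set \<Rightarrow> 'a \<Rightarrow> 'b set" where
  "visible_bar N x = {xb. (x, xb) \<in> N}"

text \<open>Components, in a chart, of the differential of the cost along each of the two factors.\<close>

definition Dcost :: "('a \<times> 'b \<Rightarrow> real) \<Rightarrow> ('a, 'n::finite) chart \<Rightarrow> 'a \<Rightarrow> 'b \<Rightarrow> real^'n" where
  "Dcost c \<phi> x xb = (\<chi> i. partial_deriv i (\<lambda>u. c (chart_inv \<phi> u, xb)) (snd \<phi> x))"

definition Dcost_bar :: "('a \<times> 'b \<Rightarrow> real) \<Rightarrow> ('b, 'n::finite) chart \<Rightarrow> 'a \<Rightarrow> 'b \<Rightarrow> real^'n" where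
  "Dcost_bar c \<psi> x xb = (\<chi> j. partial_deriv j (\<lambda>u. c (x, chart_inv \<psi> u)) (snd \<psi> xb))"

definition bi_twisted ::
  "('a, 'n::finite) chart set \<Rightarrow> ('b, 'n) chart set \<Rightarrow> ('a \<times> 'b) set
    \<Rightarrow> ('a \<times> 'b \<Rightarrow> real) \<Rightarrow> bool" where
  "bi_twisted A B N c \<longleftrightarrow> (\<forall>(x, xb)\<in>N.
     (\<forall>\<phi>\<in>A. x \<in> fst \<phi> \<longrightarrow> inj_on (\<lambda>yb. Dcost c \<phi> x yb) (visible_bar N x)) \<and>
     (\<forall>\<psi>\<in>B. xb \<in> fst \<psi> \<longrightarrow> inj_on (\<lambda>y. Dcost_bar c \<psi> y xb) (visible N xb)))"

definition mixed_hessian :: "(real^('n::finite + 'n) \<Rightarrow> real) \<Rightarrow> real^('n + 'n) \<Rightarrow> real^'n^'n" where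
  "mixed_hessian f z = (\<chi> i j. partial_deriv (Inl i) (partial_deriv (Inr j) f) z)"

definition non_degenerate ::
  "('a, 'n::finite) chart set \<Rightarrow> ('b, 'n) chart set \<Rightarrow> ('a \<times> 'b) set
    \<Rightarrow> ('a \<times> 'b \<Rightarrow> real) \<Rightarrow> bool" where
  "non_degenerate A B N c \<longleftrightarrow> (\<forall>\<phi>\<in>A. \<forall>\<psi>\<in>B. \<forall>P \<in> N \<inter> fst \<phi> \<times> fst \<psi>.
     invertible (mixed_hessian (local_cost c \<phi> \<psi>) (coords \<phi> \<psi> P)))"


section \<open>The induced metric, its geodesics and its cross-curvature\<close>

definition cost_metric :: "(real^('n::finite + 'n) \<Rightarrow> real) \<Rightarrow> ('n + 'n) metric" where
  "cost_metric f z = (\<chi> a b. case (a, b) of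
       (Inl i, Inr j) \<Rightarrow> - (1/2) * partial_deriv a (partial_deriv b f) z
     | (Inr i, Inl j) \<Rightarrow> - (1/2) * partial_deriv a (partial_deriv b f) z
     | _ \<Rightarrow> 0)"

definition cross_curvature ::
  "('a \<times> 'b \<Rightarrow> real) \<Rightarrow> ('a, 'n::finite) chart \<Rightarrow> ('b, 'n) chart \<Rightarrow> 'a \<times> 'b
    \<Rightarrow> real^'n \<Rightarrow> real^'n \<Rightarrow> real" where
  "cross_curvature c \<phi> \<psi> P p pb =
     curvature_operator (cost_metric (local_cost c \<phi> \<psi>)) (coords \<phi> \<psi> P)
       (wedge (dsum p 0) (dsum 0 pb)) (wedge (dsum p 0) (dsum 0 pb))"

definition nonneg_cross_curved ::
  "('a, 'n::finite) chart set \<Rightarrow> ('b, 'n) chart set \<Rightarrow> ('a \<times> 'b) set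
    \<Rightarrow> ('a \<times> 'b \<Rightarrow> real) \<Rightarrow> bool" where
  "nonneg_cross_curved A B N c \<longleftrightarrow>
     (\<forall>\<phi>\<in>A. \<forall>\<psi>\<in>B. \<forall>P \<in> N \<inter> fst \<phi> \<times> fst \<psi>. \<forall>p pb. cross_curvature c \<phi> \<psi> P p pb \<ge> 0)"

text \<open>
  Affinely parametrized geodesics on \<open>[0,1]\<close>, constant ones included. Continuity of \<open>\<gamma>\<close> keeps
  \<open>\<gamma>\<close> inside the product chart near \<open>t\<close>, so the unspecified values of the coordinates and of the
  velocity \<open>v\<close> elsewhere do not affect the derivatives at \<open>t\<close>.
\<close>

definition h_geodesic ::
  "('a::topological_space, 'n::finite) chart set \<Rightarrow> ('b::topological_space, 'n) chart set
    \<Rightarrow> ('a \<times> 'b) set \<Rightarrow> ('a \<times> 'b \<Rightarrow> real) \<Rightarrow> (real \<Rightarrow> 'a \<times> 'b) \<Rightarrow> bool" where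
  "h_geodesic A B N c \<gamma> \<longleftrightarrow>
     continuous_on {0..1} \<gamma> \<and> \<gamma> ` {0..1} \<subseteq> N \<and>
     (\<forall>\<phi>\<in>A. \<forall>\<psi>\<in>B. \<exists>v. \<forall>t\<in>{0..1}. \<gamma> t \<in> fst \<phi> \<times> fst \<psi> \<longrightarrow>
        ((\<lambda>s. coords \<phi> \<psi> (\<gamma> s)) has_vector_derivative v t) (at t within {0..1}) \<and>
        (v has_vector_derivative
          (\<chi> k. - (\<Sum>i\<in>UNIV. \<Sum>j\<in>UNIV.
             christoffel (cost_metric (local_cost c \<phi> \<psi>)) k i j (coords \<phi> \<psi> (\<gamma> t))
               * v t $ i * v t $ j)))
          (at t within {0..1}))"

text \<open>The illuminated set \<open>V(x, xb)\<close>.\<close>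

definition illuminated ::
  "('a::topological_space, 'n::finite) chart set \<Rightarrow> ('b::topological_space, 'n) chart set
    \<Rightarrow> ('a \<times> 'b) set \<Rightarrow> ('a \<times> 'b \<Rightarrow> real) \<Rightarrow> 'a \<Rightarrow> 'b \<Rightarrow> 'a set" where
  "illuminated A B N c x xb = {y \<in> visible N xb. \<exists>\<gamma>. h_geodesic A B N c \<gamma> \<and>
     \<gamma> 0 = (x, xb) \<and> \<gamma> 1 = (y, xb) \<and> (\<forall>t\<in>{0..1}. \<gamma> t \<in> visible N xb \<times> {xb})}"

end

theory Submission
  imports Defs
begin

text \<open>
  Fix \<open>t\<close> and a point \<open>y\<close> of \<open>V\<^sub>\<sigma>\<close>, and let \<open>G z\<close> be the second derivative at \<open>t\<close> of \<open>c (z, xb _)\<close>.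
  Along the geodesic \<open>s \<mapsto> (\<gamma> s, xb t)\<close> from \<open>x\<close> to \<open>y\<close> consider \<open>g s = - G (\<gamma> s)\<close>. The geodesic
  equation of \<open>\<gamma>\<close> turns \<open>g'' s\<close> into half the cross-curvature of the two velocities, so \<open>g\<close> is convex,
  and the geodesic equation of \<open>\<sigma>\<close> says that \<open>Dc (x, xb _)\<close> is affine, so \<open>g' 0 = 0\<close>. Hence
  \<open>g 0 \<le> g 1\<close>, i.e. the second derivative at \<open>t\<close> of \<open>- c (y, xb _) + c (x, xb _)\<close> is non-negative.
  Since \<open>t\<close> is arbitrary this gives convexity for \<open>y\<close> in \<open>V\<^sub>\<sigma>\<close>, and density extends it to all \<open>y\<close>.
\<close>

section \<open>Partial derivatives and derivatives along curves\<close>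

text \<open>The geodesic equations act through the shape of the metric. It pairs only vectors of
  different factors, so its Christoffel symbols vanish unless all three indices belong to the same
  factor, and the mixed Hessian contracted with such a symbol is a third derivative of the cost.
  Hence the differential of \<open>c\<close> along the second factor is affine along
  \<open>\<gamma>\<close>. In \<open>G\<close> the velocity and the acceleration of
  \<open>\<sigma>\<close> at \<open>t\<close> are frozen constants: the acceleration term has second
  derivative zero by this affinity, and the term that the acceleration of \<open>\<gamma>\<close>
  adds to the fourth derivative is exactly the correction in the cross-curvature. The curve
  \<open>\<gamma>\<close> is chosen for each \<open>t\<close> separately, and nothing relates the
  choices. The obstacle is that \<open>\<gamma>\<close> may leave every chart, so the convexity of
  \<open>g\<close> has to be assembled from second derivatives that are each computed in a chart
  near one \<open>s\<close>.\<close>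

lemma frechet_derivative_eq_sum_partial:
  fixes f :: "real^'m::finite \<Rightarrow> real"
  assumes "f differentiable (at z)"
  shows "frechet_derivative f (at z) v = (\<Sum>i\<in>UNIV. partial_deriv i f z * v $ i)"
proof -
  have lin: "linear (frechet_derivative f (at z))"
    by (rule linear_frechet_derivative[OF assms])
  have "v = (\<Sum>i\<in>UNIV. v $ i *\<^sub>R axis i 1)"
    by (simp add: vec_eq_iff axis_def if_distrib sum.delta cong: if_cong)
  then have "frechet_derivative f (at z) v = frechet_derivative f (at z) (\<Sum>i\<in>UNIV. v $ i *\<^sub>R axis i 1)"
    by simp
  also have "\<dots> = (\<Sum>i\<in>UNIV. partial_deriv i f z * v $ i)"
    by (simp add: linear_sum[OF lin] linear_scale[OF lin] partial_deriv_def mult.commute)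
  finally show ?thesis .
qed

lemma has_derivative_partial:
  fixes f :: "real^'m::finite \<Rightarrow> real"
  assumes "f differentiable (at z)"
  shows "(f has_derivative (\<lambda>v. \<Sum>i\<in>UNIV. partial_deriv i f z * v $ i)) (at z)"
proof -
  have "frechet_derivative f (at z) = (\<lambda>v. \<Sum>i\<in>UNIV. partial_deriv i f z * v $ i)"
    using frechet_derivative_eq_sum_partial[OF assms] by blast
  then show ?thesis using assms frechet_derivative_works[of f "at z"] by simp
qed

lemma partial_deriv_eqI:
  assumes "(f has_derivative D) (at z)"
  shows "partial_deriv i f z = D (axis i 1)"
  using frechet_derivative_at[OF assms] by (simp add: partial_deriv_def)

text \<open>Allows identities that hold only on a chart domain to be differentiated.\<close>

lemma partial_deriv_cong:
  assumes "open S" "z \<in> S" "f differentiable (at z)" "\<And>w. w \<in> S \<Longrightarrow> f w = g w"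
  shows "partial_deriv i f z = partial_deriv i g z"
  unfolding partial_deriv_def using frechet_derivative_transform_within_open[OF assms(3,1,2,4)] by simp

lemma has_real_derivative_along_curve:
  fixes f :: "real^'m::finite \<Rightarrow> real"
  assumes "f differentiable (at (\<zeta> s))" "(\<zeta> has_vector_derivative v) (at s within T)"
  shows "((\<lambda>r. f (\<zeta> r)) has_real_derivative (\<Sum>i\<in>UNIV. partial_deriv i f (\<zeta> s) * v $ i)) (at s within T)"
proof -
  have "((\<lambda>r. f (\<zeta> r)) has_derivative
      (\<lambda>h. \<Sum>i\<in>UNIV. partial_deriv i f (\<zeta> s) * (h *\<^sub>R v) $ i)) (at s within T)"
    using has_derivative_compose[OF assms(2)[unfolded has_vector_derivative_def]
        has_derivative_partial[OF assms(1)]] by simp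
  moreover have "(\<lambda>h. \<Sum>i\<in>UNIV. partial_deriv i f (\<zeta> s) * (h *\<^sub>R v) $ i)
      = (*) (\<Sum>i\<in>UNIV. partial_deriv i f (\<zeta> s) * v $ i)"
    by (rule ext) (simp add: sum_distrib_left sum_distrib_right mult_ac)
  ultimately show ?thesis
    by (simp add: has_field_derivative_def)
qed

lemma partial_deriv_mult:
  assumes "f differentiable (at z)" "g differentiable (at z)"
  shows "partial_deriv i (\<lambda>w. f w * g w) z = partial_deriv i f z * g z + f z * partial_deriv i g z"
proof -
  have "((\<lambda>w. f w * g w) has_derivative
      (\<lambda>h. f z * frechet_derivative g (at z) h + frechet_derivative f (at z) h * g z)) (at z)"
    using assms unfolding frechet_derivative_works by (rule has_derivative_mult)
  from partial_deriv_eqI[OF this] show ?thesis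
    by (simp add: partial_deriv_def)
qed

lemma partial_deriv_sum:
  assumes "\<And>k. k \<in> K \<Longrightarrow> f k differentiable (at z)"
  shows "partial_deriv i (\<lambda>w. \<Sum>k\<in>K. f k w) z = (\<Sum>k\<in>K. partial_deriv i (f k) z)"
proof -
  have "((\<lambda>w. \<Sum>k\<in>K. f k w) has_derivative (\<lambda>h. \<Sum>k\<in>K. frechet_derivative (f k) (at z) h)) (at z)"
    using assms unfolding frechet_derivative_works by (intro has_derivative_sum)
  from partial_deriv_eqI[OF this] show ?thesis
    by (simp add: partial_deriv_def)
qed

lemma partial_deriv_const [simp]: "partial_deriv i (\<lambda>w. a) z = 0"
  by (simp add: partial_deriv_def)

lemma partial_deriv_cmult:
  assumes "f differentiable (at z)"
  shows "partial_deriv i (\<lambda>w. a * f w) z = a * partial_deriv i f z"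
  using partial_deriv_mult[of "\<lambda>_. a" z f i] assms by simp

lemma Ck_on_differentiable: "Ck_on k S f \<Longrightarrow> 0 < k \<Longrightarrow> z \<in> S \<Longrightarrow> f differentiable (at z)"
  by (cases k) auto

lemma Ck_on_mono: "Ck_on k S f \<Longrightarrow> l \<le> k \<Longrightarrow> Ck_on l S f"
proof (induction l arbitrary: k f)
  case 0
  then show ?case
    by (cases k) (auto intro!: continuous_at_imp_continuous_on differentiable_imp_continuous_within)
next
  case (Suc l)
  then show ?case by (cases k) auto
qed

lemma Ck_on_partial: "Ck_on k S f \<Longrightarrow> Suc l \<le> k \<Longrightarrow> Ck_on l S (partial_deriv i f)"
  using Ck_on_mono[of k S f "Suc l"] by simp

section \<open>Symmetry of mixed second partial derivatives\<close>

lemma has_real_derivative_line: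
  fixes f :: "real^'m::finite \<Rightarrow> real"
  assumes "f differentiable (at (x + s *\<^sub>R axis i 1))"
  shows "((\<lambda>r. f (x + r *\<^sub>R axis i 1)) has_real_derivative partial_deriv i f (x + s *\<^sub>R axis i 1)) (at s)"
proof -
  have "((\<lambda>r. x + r *\<^sub>R axis i 1) has_vector_derivative axis i 1) (at s)"
    by (auto intro!: derivative_eq_intros)
  from has_real_derivative_along_curve[where \<zeta>="\<lambda>r. x + r *\<^sub>R axis i 1", OF assms this]
  show ?thesis by (simp add: axis_def if_distrib cong: if_cong)
qed

text \<open>The mean value theorem is applied to \<open>u\<close>, the increment in direction
  \<open>j\<close> as a function of the step in direction \<open>i\<close>, and then to the
  derivative of \<open>u\<close> in direction \<open>j\<close>. The second difference is symmetric
  in \<open>i\<close> and \<open>j\<close>, so exchanging them yields the other mixed derivative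
  from the same number. The radius \<open>2 * h\<close> leaves room for two steps of length at most
  \<open>h\<close>.\<close>

lemma second_difference_mvt:
  fixes f :: "real^'m::finite \<Rightarrow> real"
  assumes h: "0 < h" and sub: "cball x (2 * h) \<subseteq> S"
    and f: "\<And>z. z \<in> S \<Longrightarrow> f differentiable (at z)"
    and fi: "\<And>z. z \<in> S \<Longrightarrow> partial_deriv i f differentiable (at z)"
  obtains \<xi> where "\<xi> \<in> cball x (2 * h)"
    "f (x + h *\<^sub>R axis i 1 + h *\<^sub>R axis j 1) - f (x + h *\<^sub>R axis i 1) - f (x + h *\<^sub>R axis j 1) + f x
      = h * (h * partial_deriv j (partial_deriv i f) \<xi>)"
proof -
  let ?a = "axis i 1 :: real^'m" and ?b = "axis j 1 :: real^'m"
  have near: "x + s *\<^sub>R ?a + t *\<^sub>R ?b \<in> cball x (2 * h)" if "0 \<le> s" "s \<le> h" "0 \<le> t" "t \<le> h" for s t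
  proof -
    have "norm (s *\<^sub>R ?a + t *\<^sub>R ?b) \<le> \<bar>s\<bar> + \<bar>t\<bar>"
      by (rule order_trans[OF norm_triangle_ineq]) simp
    moreover have "dist x (x + s *\<^sub>R ?a + t *\<^sub>R ?b) = norm (s *\<^sub>R ?a + t *\<^sub>R ?b)"
      by (metis add.assoc add_diff_cancel_left' dist_commute dist_norm)
    ultimately show ?thesis using that by simp
  qed
  define u where "u = (\<lambda>s. f (x + h *\<^sub>R ?b + s *\<^sub>R ?a) - f (x + s *\<^sub>R ?a))"
  have n1: "x + h *\<^sub>R ?b + s *\<^sub>R ?a \<in> S" if "0 \<le> s" "s \<le> h" for s
    using near[of s h] that h sub by (auto simp: algebra_simps)
  have n2: "x + s *\<^sub>R ?a \<in> S" if "0 \<le> s" "s \<le> h" for s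
    using near[of s 0] that h sub by auto
  have "(u has_real_derivative (partial_deriv i f (x + h *\<^sub>R ?b + s *\<^sub>R ?a)
      - partial_deriv i f (x + s *\<^sub>R ?a))) (at s)" if "0 \<le> s" "s \<le> h" for s
    unfolding u_def using n1[OF that] n2[OF that]
    by (intro DERIV_diff has_real_derivative_line f)
  from MVT2[OF h, of u, OF this] obtain s where s: "0 < s" "s < h" and
    us: "u h - u 0 = h * (partial_deriv i f (x + h *\<^sub>R ?b + s *\<^sub>R ?a) - partial_deriv i f (x + s *\<^sub>R ?a))"
    by auto
  have n3: "x + s *\<^sub>R ?a + t *\<^sub>R ?b \<in> S" if "0 \<le> t" "t \<le> h" for t
    using near[of s t] that s sub by auto
  have "((\<lambda>t. partial_deriv i f (x + s *\<^sub>R ?a + t *\<^sub>R ?b)) has_real_derivative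
      partial_deriv j (partial_deriv i f) (x + s *\<^sub>R ?a + t *\<^sub>R ?b)) (at t)" if "0 \<le> t" "t \<le> h" for t
    using n3[OF that] by (intro has_real_derivative_line fi)
  from MVT2[OF h, of "\<lambda>t. partial_deriv i f (x + s *\<^sub>R ?a + t *\<^sub>R ?b)", OF this] obtain t where t: "0 < t" "t < h" and
    vt: "partial_deriv i f (x + s *\<^sub>R ?a + h *\<^sub>R ?b) - partial_deriv i f (x + s *\<^sub>R ?a)
      = h * partial_deriv j (partial_deriv i f) (x + s *\<^sub>R ?a + t *\<^sub>R ?b)"
    by auto
  show thesis
  proof (rule that)
    show "x + s *\<^sub>R ?a + t *\<^sub>R ?b \<in> cball x (2 * h)" using near s t by simp
    have "u h - u 0 = h * (h * partial_deriv j (partial_deriv i f) (x + s *\<^sub>R ?a + t *\<^sub>R ?b))"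
      using us vt by (simp add: algebra_simps)
    then show "f (x + h *\<^sub>R ?a + h *\<^sub>R ?b) - f (x + h *\<^sub>R ?a) - f (x + h *\<^sub>R ?b) + f x
      = h * (h * partial_deriv j (partial_deriv i f) (x + s *\<^sub>R ?a + t *\<^sub>R ?b))"
      by (simp add: u_def add_ac algebra_simps)
  qed
qed

text \<open>Schwarz: at points near \<open>x\<close> both mixed derivatives equal the same second
  difference divided by the square of \<open>h\<close>, and continuity of the second partials
  carries this to \<open>x\<close>.\<close>

lemma partial_deriv_commute:
  fixes f :: "real^'m::finite \<Rightarrow> real"
  assumes S: "open S" "x \<in> S" and f: "Ck_on k S f" and k: "2 \<le> k"
  shows "partial_deriv i (partial_deriv j f) x = partial_deriv j (partial_deriv i f) x"
proof (rule dense_eq0_I[of "_ - _", simplified])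
  fix e :: real assume e: "0 < e"
  have cont: "isCont (partial_deriv a (partial_deriv b f)) x" for a b
  proof -
    have "Ck_on 0 S (partial_deriv a (partial_deriv b f))"
      by (intro Ck_on_partial[OF Ck_on_partial[OF f, of 1]]) (use k in auto)
    then show ?thesis using S continuous_on_eq_continuous_at by auto
  qed
  define P where "P = partial_deriv i (partial_deriv j f)"
  define Q where "Q = partial_deriv j (partial_deriv i f)"
  obtain d1 where d1: "d1 > 0" "\<And>y. dist y x < d1 \<Longrightarrow> dist (P y) (P x) < e / 2"
    using cont[of i j] e unfolding P_def[symmetric] continuous_at_eps_delta
    by (metis half_gt_zero)
  obtain d2 where d2: "d2 > 0" "\<And>y. dist y x < d2 \<Longrightarrow> dist (Q y) (Q x) < e / 2"
    using cont[of j i] e unfolding Q_def[symmetric] continuous_at_eps_delta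
    by (metis half_gt_zero)
  obtain d3 where d3: "d3 > 0" "cball x d3 \<subseteq> S" using S open_contains_cball by blast
  \<comment> \<open>The quarter makes \<open>2 * h\<close> at most half of each radius, so both mean
    value points lie strictly inside the balls of radius \<open>d1\<close> and
    \<open>d2\<close>.\<close>
  define h where "h = min d3 (min d1 d2) / 4"
  have h: "h > 0" "2 * h < d1" "2 * h < d2" "2 * h \<le> d3" using d1 d2 d3 by (auto simp: h_def)
  then have sub: "cball x (2 * h) \<subseteq> S" using d3 by (meson order_trans subset_cball)
  have df: "f differentiable (at z)" and dp: "partial_deriv a f differentiable (at z)" if "z \<in> S" for z a
    using Ck_on_differentiable[OF f] Ck_on_differentiable[OF Ck_on_partial[OF f, of 1]] k that by auto
  obtain \<xi> where xi: "\<xi> \<in> cball x (2 * h)"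
    "f (x + h *\<^sub>R axis i 1 + h *\<^sub>R axis j 1) - f (x + h *\<^sub>R axis i 1) - f (x + h *\<^sub>R axis j 1) + f x
      = h * (h * Q \<xi>)" unfolding Q_def
    by (rule second_difference_mvt[OF h(1) sub df dp])
  obtain \<eta> where eta: "\<eta> \<in> cball x (2 * h)"
    "f (x + h *\<^sub>R axis j 1 + h *\<^sub>R axis i 1) - f (x + h *\<^sub>R axis j 1) - f (x + h *\<^sub>R axis i 1) + f x
      = h * (h * P \<eta>)" unfolding P_def
    by (rule second_difference_mvt[OF h(1) sub df dp])
  have swap: "x + h *\<^sub>R axis j 1 + h *\<^sub>R axis i 1 = x + h *\<^sub>R axis i 1 + h *\<^sub>R axis j 1"
    by (simp add: add_ac)
  have "h * (h * Q \<xi>) = h * (h * P \<eta>)"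
    using xi(2) eta(2) unfolding swap by linarith
  then have "Q \<xi> = P \<eta>" using h by simp
  moreover have "dist (Q \<xi>) (Q x) < e / 2" "dist (P \<eta>) (P x) < e / 2"
    using d2(2)[of \<xi>] d1(2)[of \<eta>] xi(1) eta(1) h by (simp_all add: dist_commute)
  ultimately have "\<bar>P x - Q x\<bar> < e" unfolding dist_real_def by linarith
  then show "\<bar>partial_deriv i (partial_deriv j f) x - partial_deriv j (partial_deriv i f) x\<bar> \<le> e"
    by (simp add: P_def Q_def)
qed


section \<open>Coordinates on a direct sum\<close>

lemma sum_UNIV_Plus:
  fixes f :: "'p::finite + 'q::finite \<Rightarrow> 'r::comm_monoid_add"
  shows "(\<Sum>a\<in>UNIV. f a) = (\<Sum>i\<in>UNIV. f (Inl i)) + (\<Sum>j\<in>UNIV. f (Inr j))"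
  using sum.Plus[of UNIV UNIV f] by (simp add: comp_def)

lemma dsum_simps [simp]: "dsum p q $ Inl i = p $ i" "dsum p q $ Inr i = q $ i"
  by (simp_all add: dsum_def)

lemma pr_dsum [simp]: "pr1 (dsum p q) = p" "pr2 (dsum p q) = q"
  by (simp_all add: pr1_def pr2_def)

lemma dsum_pr: "dsum (pr1 z) (pr2 z) = z"
  by (simp add: dsum_def pr1_def pr2_def vec_eq_iff split: sum.split)

lemma bounded_linear_pr1: "bounded_linear pr1"
  and bounded_linear_pr2: "bounded_linear pr2"
  unfolding linear_conv_bounded_linear[symmetric]
  by (rule linearI; simp add: pr1_def pr2_def vec_eq_iff)+

lemma bounded_linear_dsum_left: "bounded_linear (\<lambda>p. dsum p 0)"
  and bounded_linear_dsum_right: "bounded_linear (\<lambda>q. dsum 0 q)"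
  unfolding linear_conv_bounded_linear[symmetric]
  by (rule linearI; simp add: dsum_def vec_eq_iff split: sum.split)+

lemma dsum_split: "dsum p q = dsum p 0 + dsum 0 q"
  by (simp add: dsum_def vec_eq_iff split: sum.split)

lemma has_vector_derivative_dsum_left:
  assumes "(p has_vector_derivative p') F"
  shows "((\<lambda>r. dsum (p r) w) has_vector_derivative dsum p' 0) F"
proof -
  have "((\<lambda>r. dsum (p r) 0 + dsum 0 w) has_vector_derivative dsum p' 0 + 0) F"
    by (intro has_vector_derivative_add has_vector_derivative_const
        bounded_linear.has_vector_derivative[OF bounded_linear_dsum_left assms])
  then show ?thesis by (simp flip: dsum_split)
qed

lemma has_vector_derivative_dsum_right:
  assumes "(p has_vector_derivative p') F"
  shows "((\<lambda>r. dsum u (p r)) has_vector_derivative dsum 0 p') F"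
proof -
  have "((\<lambda>r. dsum u 0 + dsum 0 (p r)) has_vector_derivative 0 + dsum 0 p') F"
    by (intro has_vector_derivative_add has_vector_derivative_const
        bounded_linear.has_vector_derivative[OF bounded_linear_dsum_right assms])
  then show ?thesis by (simp flip: dsum_split)
qed

section \<open>Second derivatives on the unit interval and convexity\<close>

text \<open>The first derivative \<open>a\<close> is recorded only near \<open>s\<close>, because it
  will come from a chart around one point of a curve; \<open>b\<close> is the second derivative at
  \<open>s\<close> alone. Derivatives are one-sided at the ends of the interval.\<close>

definition has_deriv2 :: "(real \<Rightarrow> real) \<Rightarrow> (real \<Rightarrow> real) \<Rightarrow> real \<Rightarrow> real \<Rightarrow> bool" where
  "has_deriv2 g a b s \<longleftrightarrow>
     (\<forall>\<^sub>F r in nhds s. r \<in> {0..1} \<longrightarrow> (g has_real_derivative a r) (at r within {0..1})) \<and>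
     (a has_real_derivative b) (at s within {0..1})"

lemma has_deriv2_add:
  assumes "has_deriv2 g a b s" "has_deriv2 g' a' b' s"
  shows "has_deriv2 (\<lambda>r. g r + g' r) (\<lambda>r. a r + a' r) (b + b') s"
  unfolding has_deriv2_def
proof
  have "\<forall>\<^sub>F r in nhds s. r \<in> {0..1} \<longrightarrow> (g has_real_derivative a r) (at r within {0..1})"
    "\<forall>\<^sub>F r in nhds s. r \<in> {0..1} \<longrightarrow> (g' has_real_derivative a' r) (at r within {0..1})"
    using assms by (simp_all only: has_deriv2_def)
  then show "\<forall>\<^sub>F r in nhds s. r \<in> {0..1} \<longrightarrow>
      ((\<lambda>r. g r + g' r) has_real_derivative a r + a' r) (at r within {0..1})"
    by eventually_elim (blast intro: DERIV_add)
  show "((\<lambda>r. a r + a' r) has_real_derivative b + b') (at s within {0..1})"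
    using assms by (auto simp: has_deriv2_def intro: DERIV_add)
qed

lemma has_deriv2_cmult:
  assumes "has_deriv2 g a b s"
  shows "has_deriv2 (\<lambda>r. k * g r) (\<lambda>r. k * a r) (k * b) s"
  unfolding has_deriv2_def
proof
  have "\<forall>\<^sub>F r in nhds s. r \<in> {0..1} \<longrightarrow> (g has_real_derivative a r) (at r within {0..1})"
    using assms by (simp only: has_deriv2_def)
  then show "\<forall>\<^sub>F r in nhds s. r \<in> {0..1} \<longrightarrow>
      ((\<lambda>r. k * g r) has_real_derivative k * a r) (at r within {0..1})"
    by eventually_elim (blast intro: DERIV_cmult)
  show "((\<lambda>r. k * a r) has_real_derivative k * b) (at s within {0..1})"
    using assms by (auto simp: has_deriv2_def intro: DERIV_cmult)
qed

lemma has_deriv2_sum: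
  assumes "finite K" "\<And>k. k \<in> K \<Longrightarrow> has_deriv2 (g k) (a k) (b k) s"
  shows "has_deriv2 (\<lambda>r. \<Sum>k\<in>K. g k r) (\<lambda>r. \<Sum>k\<in>K. a k r) (\<Sum>k\<in>K. b k) s"
  using assms
proof (induction K)
  case empty
  show ?case by (simp add: has_deriv2_def)
next
  case (insert x K)
  then show ?case using has_deriv2_add[of "g x" "a x" "b x" s] by simp
qed

text \<open>Agreement near \<open>s\<close> is also agreement near every \<open>r\<close> close to
  \<open>s\<close>, which is what transferring the derivative at \<open>r\<close> requires.\<close>

lemma has_deriv2_cong:
  assumes "has_deriv2 g a b s" "\<forall>\<^sub>F r in nhds s. r \<in> {0..1} \<longrightarrow> g r = g' r"
  shows "has_deriv2 g' a b s"
proof -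
  have "\<forall>\<^sub>F r in nhds s. \<forall>\<^sub>F r' in nhds r. r' \<in> {0..1} \<longrightarrow> g r' = g' r'"
    using assms(2) by (simp add: eventually_eventually)
  moreover have "\<forall>\<^sub>F r in nhds s. r \<in> {0..1} \<longrightarrow> (g has_real_derivative a r) (at r within {0..1})"
    using assms(1) by (simp add: has_deriv2_def)
  ultimately have "\<forall>\<^sub>F r in nhds s. r \<in> {0..1} \<longrightarrow> (g' has_real_derivative a r) (at r within {0..1})"
  proof eventually_elim
    case (elim r)
    show ?case
    proof
      assume r: "r \<in> {0..1}"
      obtain d where "0 < d" "\<And>r'. dist r' r < d \<Longrightarrow> r' \<in> {0..1} \<Longrightarrow> g r' = g' r'"
        using elim(1) unfolding eventually_nhds_metric by blast
      then show "(g' has_real_derivative a r) (at r within {0..1})"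
        using has_field_derivative_transform_within[of g "a r" r "{0..1}" d g'] elim(2) r by auto
    qed
  qed
  then show ?thesis using assms(1) by (simp add: has_deriv2_def)
qed

text \<open>The local first derivatives agree on overlaps, so they need not come from a single formula.\<close>

lemma has_deriv2_nonneg_imp_mono_deriv:
  assumes "\<And>s. s \<in> {0..1} \<Longrightarrow> \<exists>a b. has_deriv2 g a b s \<and> 0 \<le> b"
  obtains a where "\<And>s. s \<in> {0..1} \<Longrightarrow> (g has_real_derivative a s) (at s within {0..1})"
    "\<And>s t. 0 \<le> s \<Longrightarrow> s \<le> t \<Longrightarrow> t \<le> 1 \<Longrightarrow> a s \<le> a t"
proof -
  define A where "A s = vector_derivative g (at s within {0..1})" for s
  have unique: "A s = a s" if "s \<in> {0..1}" "(g has_real_derivative a s) (at s within {0..1})" for s a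
    using vector_derivative_within_cbox[of 0 1 s g "a s"] that unfolding A_def
    by (simp add: has_real_derivative_iff_has_vector_derivative)
  have "\<exists>b\<ge>0. (g has_real_derivative A s) (at s within {0..1}) \<and>
      (A has_real_derivative b) (at s within {0..1})" if s: "s \<in> {0..1}" for s
  proof -
    obtain a b where ab: "\<forall>\<^sub>F r in nhds s. r \<in> {0..1} \<longrightarrow> (g has_real_derivative a r) (at r within {0..1})"
      "(a has_real_derivative b) (at s within {0..1})" "0 \<le> b"
      using assms[OF s] unfolding has_deriv2_def by blast
    obtain d where d: "0 < d" "\<And>r. dist r s < d \<Longrightarrow> r \<in> {0..1} \<Longrightarrow> (g has_real_derivative a r) (at r within {0..1})"
      using ab(1) unfolding eventually_nhds_metric by blast
    have "A r = a r" if "dist r s < d" "r \<in> {0..1}" for r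
      using unique d(2) that by blast
    then have "(A has_real_derivative b) (at s within {0..1})"
      using has_field_derivative_transform_within[OF ab(2) d(1) s, of A] by auto
    moreover have "(g has_real_derivative A s) (at s within {0..1})"
      using d(2)[of s] d(1) s unique by fastforce
    ultimately show ?thesis using ab(3) by blast
  qed
  then obtain B where B: "\<And>s. s \<in> {0..1} \<Longrightarrow> 0 \<le> B s"
      "\<And>s. s \<in> {0..1} \<Longrightarrow> (g has_real_derivative A s) (at s within {0..1})"
      "\<And>s. s \<in> {0..1} \<Longrightarrow> (A has_real_derivative B s) (at s within {0..1})"
    by metis
  have "A s \<le> A t" if st: "0 \<le> s" "s \<le> t" "t \<le> 1" for s t
  proof (rule DERIV_nonneg_imp_increasing_open[OF st(2)])
    show "continuous_on {s..t} A"
    proof (rule DERIV_continuous_on)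
      fix r assume "r \<in> {s..t}"
      then show "(A has_real_derivative B r) (at r within {s..t})"
        using st by (intro has_field_derivative_subset[OF B(3)]) auto
    qed
    show "\<exists>y. (A has_real_derivative y) (at r) \<and> 0 \<le> y" if "s < r" "r < t" for r
      using B(1)[of r] B(3)[of r] that st at_within_Icc_at[of 0 r 1] by auto
  qed
  then show thesis using that B(2) by blast
qed

lemma mvt_unit_interval:
  fixes g :: "real \<Rightarrow> real"
  assumes der: "\<And>s. s \<in> {0..1} \<Longrightarrow> (g has_real_derivative a s) (at s within {0..1})"
    and pq: "0 \<le> p" "p < q" "q \<le> 1"
  obtains y where "p < y" "y < q" "g q - g p = a y * (q - p)"
proof -
  have "\<exists>y\<in>{p<..<q}. g q - g p = a y * (q - p)"
  proof (rule mvt_simple[OF pq(2)])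
    fix y assume y: "p \<le> y" "y \<le> q"
    have "(g has_real_derivative a y) (at y within {p..q})"
      by (rule has_field_derivative_subset[OF der]) (use y pq in auto)
    then show "(g has_derivative (*) (a y)) (at y within {p..q})"
      by (simp only: has_field_derivative_def)
  qed
  then show thesis using that by auto
qed

text \<open>The increment over the interval is \<open>a z\<close> at an intermediate
  \<open>z\<close>, hence at least \<open>a 0\<close>. It is applied with
  \<open>a 0 = 0\<close>.\<close>

lemma mono_deriv_tangent:
  fixes g :: "real \<Rightarrow> real"
  assumes der: "\<And>s. s \<in> {0..1} \<Longrightarrow> (g has_real_derivative a s) (at s within {0..1})"
    and mono: "\<And>s t. 0 \<le> s \<Longrightarrow> s \<le> t \<Longrightarrow> t \<le> 1 \<Longrightarrow> a s \<le> a t"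
  shows "g 0 + a 0 \<le> g 1"
proof -
  obtain z where "0 < z" "z < 1" "g 1 - g 0 = a z * (1 - 0)"
    by (rule mvt_unit_interval[OF der, of 0 1]) auto
  then show ?thesis using mono[of 0 z] by simp
qed

text \<open>The slopes of the chords over \<open>[0,t]\<close> and \<open>[t,1]\<close> are values
  of \<open>a\<close> on either side of \<open>t\<close>, hence ordered; multiplying by
  \<open>t * (1 - t)\<close> clears the two denominators.\<close>

lemma mono_deriv_chord:
  fixes g :: "real \<Rightarrow> real"
  assumes der: "\<And>s. s \<in> {0..1} \<Longrightarrow> (g has_real_derivative a s) (at s within {0..1})"
    and mono: "\<And>s t. 0 \<le> s \<Longrightarrow> s \<le> t \<Longrightarrow> t \<le> 1 \<Longrightarrow> a s \<le> a t"
    and t: "t \<in> {0..1}"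
  shows "g t \<le> (1 - t) * g 0 + t * g 1"
proof (cases "t = 0 \<or> t = 1")
  case False
  then have t': "0 < t" "t < 1" using t by auto
  obtain y where y: "0 < y" "y < t" "g t - g 0 = a y * (t - 0)"
    by (rule mvt_unit_interval[OF der, of 0 t]) (use t' in auto)
  obtain z where z: "t < z" "z < 1" "g 1 - g t = a z * (1 - t)"
    by (rule mvt_unit_interval[OF der, of t 1]) (use t' in auto)
  have "a y \<le> a z"
    using mono[of y z] y(1,2) z(1,2) by linarith
  then have "(t * (1 - t)) * a y \<le> (t * (1 - t)) * a z"
    using t' by (intro mult_left_mono) auto
  moreover have "(t * (1 - t)) * a y = (1 - t) * (g t - g 0)" "(t * (1 - t)) * a z = t * (g 1 - g t)"
    unfolding y z by simp_all
  ultimately have "(1 - t) * (g t - g 0) \<le> t * (g 1 - g t)" by linarith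
  then show ?thesis by (simp add: left_diff_distrib right_diff_distrib)
qed auto

section \<open>Second-order chain rule along curves\<close>

lemma has_deriv2_along_curve:
  fixes E :: "real^'m::finite \<Rightarrow> real"
  assumes E: "Ck_on 2 U E" and s: "s \<in> {0..1}"
    and \<zeta>: "\<forall>\<^sub>F r in nhds s. r \<in> {0..1} \<longrightarrow> \<zeta> r \<in> U \<and> (\<zeta> has_vector_derivative v r) (at r within {0..1})"
    and v: "(v has_vector_derivative w) (at s within {0..1})"
  shows "has_deriv2 (\<lambda>r. E (\<zeta> r)) (\<lambda>r. \<Sum>i\<in>UNIV. partial_deriv i E (\<zeta> r) * v r $ i)
    ((\<Sum>i\<in>UNIV. \<Sum>j\<in>UNIV. partial_deriv j (partial_deriv i E) (\<zeta> s) * v s $ j * v s $ i)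
      + (\<Sum>i\<in>UNIV. partial_deriv i E (\<zeta> s) * w $ i)) s"
  unfolding has_deriv2_def
proof
  have dE: "E differentiable (at z)" and dE': "partial_deriv i E differentiable (at z)" if "z \<in> U" for z i
    using Ck_on_differentiable[OF E] Ck_on_differentiable[OF Ck_on_partial[OF E, of 1]] that by auto
  show "\<forall>\<^sub>F r in nhds s. r \<in> {0..1} \<longrightarrow> ((\<lambda>r. E (\<zeta> r)) has_real_derivative
      (\<Sum>i\<in>UNIV. partial_deriv i E (\<zeta> r) * v r $ i)) (at r within {0..1})"
    using \<zeta> by eventually_elim (simp add: has_real_derivative_along_curve[where f=E and \<zeta>=\<zeta>] dE)
  have zs: "\<zeta> s \<in> U" "(\<zeta> has_vector_derivative v s) (at s within {0..1})"
    using eventually_nhds_x_imp_x[OF \<zeta>] s by auto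
  have vi: "((\<lambda>r. v r $ i) has_real_derivative w $ i) (at s within {0..1})" for i
    using bounded_linear.has_vector_derivative[OF bounded_linear_vec_nth v]
    by (simp add: has_real_derivative_iff_has_vector_derivative)
  have "((\<lambda>r. \<Sum>i\<in>UNIV. partial_deriv i E (\<zeta> r) * v r $ i) has_real_derivative
     (\<Sum>i\<in>UNIV. (\<Sum>j\<in>UNIV. partial_deriv j (partial_deriv i E) (\<zeta> s) * v s $ j) * v s $ i
       + w $ i * partial_deriv i E (\<zeta> s))) (at s within {0..1})"
    by (intro DERIV_sum DERIV_mult vi has_real_derivative_along_curve[where \<zeta>=\<zeta>, OF dE'[OF zs(1)] zs(2)])
  then show "((\<lambda>r. \<Sum>i\<in>UNIV. partial_deriv i E (\<zeta> r) * v r $ i) has_real_derivative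
     ((\<Sum>i\<in>UNIV. \<Sum>j\<in>UNIV. partial_deriv j (partial_deriv i E) (\<zeta> s) * v s $ j * v s $ i)
      + (\<Sum>i\<in>UNIV. partial_deriv i E (\<zeta> s) * w $ i))) (at s within {0..1})"
    by (simp only: sum.distrib sum_distrib_right mult.commute[of "w $ _"])
qed

lemma has_deriv2_left:
  fixes E :: "real^('n::finite + 'n) \<Rightarrow> real"
  assumes E: "Ck_on 2 U E" and s: "s \<in> {0..1}"
    and \<zeta>: "\<forall>\<^sub>F r in nhds s. r \<in> {0..1} \<longrightarrow> dsum (\<zeta> r) w \<in> U \<and> (\<zeta> has_vector_derivative v r) (at r within {0..1})"
    and v: "(v has_vector_derivative a) (at s within {0..1})"
  shows "has_deriv2 (\<lambda>r. E (dsum (\<zeta> r) w)) (\<lambda>r. \<Sum>i\<in>UNIV. partial_deriv (Inl i) E (dsum (\<zeta> r) w) * v r $ i)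
    ((\<Sum>i\<in>UNIV. \<Sum>j\<in>UNIV. partial_deriv (Inl j) (partial_deriv (Inl i) E) (dsum (\<zeta> s) w) * v s $ j * v s $ i)
      + (\<Sum>i\<in>UNIV. partial_deriv (Inl i) E (dsum (\<zeta> s) w) * a $ i)) s"
proof -
  have "\<forall>\<^sub>F r in nhds s. r \<in> {0..1} \<longrightarrow> dsum (\<zeta> r) w \<in> U \<and>
      ((\<lambda>r. dsum (\<zeta> r) w) has_vector_derivative dsum (v r) 0) (at r within {0..1})"
    using \<zeta> by eventually_elim (auto intro: has_vector_derivative_dsum_left)
  from has_deriv2_along_curve[OF E s this has_vector_derivative_dsum_left[OF v]]
  show ?thesis by (simp add: sum_UNIV_Plus)
qed

lemma has_deriv2_right:
  fixes E :: "real^('n::finite + 'n) \<Rightarrow> real"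
  assumes E: "Ck_on 2 U E" and s: "s \<in> {0..1}"
    and \<zeta>: "\<forall>\<^sub>F r in nhds s. r \<in> {0..1} \<longrightarrow> dsum u (\<zeta> r) \<in> U \<and> (\<zeta> has_vector_derivative v r) (at r within {0..1})"
    and v: "(v has_vector_derivative a) (at s within {0..1})"
  shows "has_deriv2 (\<lambda>r. E (dsum u (\<zeta> r))) (\<lambda>r. \<Sum>i\<in>UNIV. partial_deriv (Inr i) E (dsum u (\<zeta> r)) * v r $ i)
    ((\<Sum>i\<in>UNIV. \<Sum>j\<in>UNIV. partial_deriv (Inr j) (partial_deriv (Inr i) E) (dsum u (\<zeta> s)) * v s $ j * v s $ i)
      + (\<Sum>i\<in>UNIV. partial_deriv (Inr i) E (dsum u (\<zeta> s)) * a $ i)) s"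
proof -
  have "\<forall>\<^sub>F r in nhds s. r \<in> {0..1} \<longrightarrow> dsum u (\<zeta> r) \<in> U \<and>
      ((\<lambda>r. dsum u (\<zeta> r)) has_vector_derivative dsum 0 (v r)) (at r within {0..1})"
    using \<zeta> by eventually_elim (auto intro: has_vector_derivative_dsum_right)
  from has_deriv2_along_curve[OF E s this has_vector_derivative_dsum_right[OF v]]
  show ?thesis by (simp add: sum_UNIV_Plus)
qed

lemma partial_deriv_slice:
  fixes E :: "real^('n::finite + 'n) \<Rightarrow> real"
  assumes "E differentiable (at (dsum u w))"
  shows "partial_deriv k (\<lambda>w. E (dsum u w)) w = partial_deriv (Inr k) E (dsum u w)"
    and "(\<lambda>w. E (dsum u w)) differentiable (at w)"
proof -
  have "((\<lambda>w. dsum u w) has_derivative (\<lambda>h. dsum 0 h)) (at w)"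
    using has_derivative_add[OF has_derivative_const[of "dsum u 0"]
        bounded_linear_imp_has_derivative[OF bounded_linear_dsum_right]]
    by (simp flip: dsum_split)
  from has_derivative_compose[OF this has_derivative_partial[OF assms]]
  have *: "((\<lambda>w. E (dsum u w)) has_derivative
    (\<lambda>h. \<Sum>i\<in>UNIV. partial_deriv i E (dsum u w) * dsum 0 h $ i)) (at w)" .
  from partial_deriv_eqI[OF *] show "partial_deriv k (\<lambda>w. E (dsum u w)) w = partial_deriv (Inr k) E (dsum u w)"
    by (simp add: sum_UNIV_Plus axis_def if_distrib cong: if_cong)
  show "(\<lambda>w. E (dsum u w)) differentiable (at w)" using * by (auto simp: differentiable_def)
qed

section \<open>Differentiability of the matrix inverse\<close>

lemma matrix_inv_right_inverse:
  fixes A :: "real^'m^'m"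
  assumes "invertible A"
  shows "A ** matrix_inv A = mat 1"
  using assms unfolding invertible_def matrix_inv_def by (metis (mono_tags, lifting) someI_ex)

text \<open>As quotients of determinants, the entries of the inverse depend differentiably on a
  parameter whenever the entries of the matrix do. The Christoffel symbols get their
  differentiability from this.\<close>

lemma matrix_inv_cramer:
  fixes A :: "real^'m::finite^'m"
  assumes "invertible A"
  shows "matrix_inv A $ k $ l = det (\<chi> i j. if j = k then axis l 1 $ i else A $ i $ j) / det A"
proof -
  have "A *v (\<chi> k. matrix_inv A $ k $ l) = axis l 1"
    using arg_cong[OF matrix_inv_right_inverse[OF assms], of "\<lambda>B. \<chi> i. B $ i $ l"]
    by (simp add: vec_eq_iff matrix_matrix_mult_def matrix_vector_mult_def mat_def axis_def)
  then show ?thesis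
    using cramer[of A "\<chi> k. matrix_inv A $ k $ l" "axis l 1"] assms
    by (simp add: invertible_det_nz vec_eq_iff)
qed

lemma differentiable_prod_real:
  fixes f :: "'i \<Rightarrow> 'a::real_normed_vector \<Rightarrow> real"
  assumes "\<And>i. i \<in> K \<Longrightarrow> f i differentiable (at z)"
  shows "(\<lambda>w. \<Prod>i\<in>K. f i w) differentiable (at z)"
  using assms by (induction K rule: infinite_finite_induct) auto

lemma differentiable_det:
  fixes A :: "'a::real_normed_vector \<Rightarrow> real^'m::finite^'m"
  assumes "\<And>i j. (\<lambda>w. A w $ i $ j) differentiable (at z)"
  shows "(\<lambda>w. det (A w)) differentiable (at z)"
  unfolding det_def
  by (intro differentiable_sum ballI differentiable_mult differentiable_const differentiable_prod_real assms
      finite_permutations finite)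

lemma differentiable_matrix_inv:
  fixes A :: "'a::real_normed_vector \<Rightarrow> real^'m::finite^'m"
  assumes U: "open U" "z \<in> U" and inv: "\<And>w. w \<in> U \<Longrightarrow> invertible (A w)"
    and A: "\<And>i j. (\<lambda>w. A w $ i $ j) differentiable (at z)"
  shows "(\<lambda>w. matrix_inv (A w) $ k $ l) differentiable (at z)"
proof -
  have "(\<lambda>w. det (\<chi> i j. if j = k then axis l 1 $ i else A w $ i $ j) / det (A w)) differentiable (at z)"
  proof (intro differentiable_divide differentiable_det)
    show "(\<lambda>w. (\<chi> i j. if j = k then axis l 1 $ i else A w $ i $ j) $ i $ j) differentiable (at z)" for i j
      by (cases "j = k") (simp_all add: A)
    show "det (A z) \<noteq> 0" using inv[OF U(2)] by (simp add: invertible_det_nz)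
  qed (rule A)
  then obtain D where "((\<lambda>w. det (\<chi> i j. if j = k then axis l 1 $ i else A w $ i $ j) / det (A w))
      has_derivative D) (at z)" by (auto simp: differentiable_def)
  from has_derivative_transform_within_open[OF this U, of "\<lambda>w. matrix_inv (A w) $ k $ l"]
  show ?thesis using inv by (auto simp: differentiable_def matrix_inv_cramer)
qed

lemma riemann_antisym: "riemann g l k j i z = - riemann g l k i j z"
  by (simp add: riemann_def sum_subtractf)

section \<open>The curvature of a cost metric\<close>

text \<open>A single product chart: \<open>F\<close> stands for the cost in coordinates and
  \<open>U\<close> for the image of the part of \<open>N\<close> that the chart covers.\<close>

locale cost_domain =
  fixes F :: "real^('n::finite + 'n) \<Rightarrow> real" and U :: "(real^('n + 'n)) set"
  assumes open_U: "open U" and C4: "Ck_on 4 U F"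
    and mixed_invertible: "\<And>z. z \<in> U \<Longrightarrow> invertible (mixed_hessian F z)"
begin

abbreviation \<Gamma> where "\<Gamma> \<equiv> christoffel (cost_metric F)"
abbreviation H where "H z i j \<equiv> partial_deriv (Inl i) (partial_deriv (Inr j) F) z"

abbreviation d3 where "d3 a b c \<equiv> partial_deriv a (partial_deriv b (partial_deriv c F))"
abbreviation d4 where "d4 a b c d \<equiv> partial_deriv a (partial_deriv b (partial_deriv c (partial_deriv d F)))"

section \<open>Partial derivatives of the cost and non-degeneracy of its metric\<close>

lemma C3: "Ck_on 3 U (partial_deriv a F)"
  and C2: "Ck_on 2 U (partial_deriv a (partial_deriv b F))"
  and C1: "Ck_on 1 U (d3 a b c)"
proof -
  show *: "Ck_on 3 U (partial_deriv a F)" for a by (rule Ck_on_partial[OF C4]) simp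
  show **: "Ck_on 2 U (partial_deriv a (partial_deriv b F))" for a b by (rule Ck_on_partial[OF *]) simp
  show "Ck_on 1 U (d3 a b c)" by (rule Ck_on_partial[OF **]) simp
qed

lemma differentiable_partials:
  assumes "z \<in> U"
  shows "partial_deriv a F differentiable (at z)"
    "partial_deriv a (partial_deriv b F) differentiable (at z)"
    "d3 a b c differentiable (at z)"
  using assms by (auto intro: Ck_on_differentiable[OF C3] Ck_on_differentiable[OF C2] Ck_on_differentiable[OF C1])

lemma d2_swap: "z \<in> U \<Longrightarrow> partial_deriv a (partial_deriv b F) z = partial_deriv b (partial_deriv a F) z"
  by (rule partial_deriv_commute[OF open_U _ C4]) auto

lemma d3_swap1: "z \<in> U \<Longrightarrow> d3 a b c z = d3 b a c z"
  by (rule partial_deriv_commute[OF open_U _ C3]) auto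

text \<open>Schwarz exchanges only the two outermost derivatives. An exchange further inside is an
  identity on all of the open set \<open>U\<close>, and that identity is differentiated;
  \<open>d4_swap2\<close> works in the same way.\<close>

lemma d3_swap2: "z \<in> U \<Longrightarrow> d3 a b c z = d3 a c b z"
  by (rule partial_deriv_cong[OF open_U]) (auto intro: d2_swap differentiable_partials)

lemma d4_swap1: "z \<in> U \<Longrightarrow> d4 a b c d z = d4 b a c d z"
  by (rule partial_deriv_commute[OF open_U _ C2]) auto

lemma d4_swap2: "z \<in> U \<Longrightarrow> d4 a b c d z = d4 a c b d z"
  by (rule partial_deriv_cong[OF open_U]) (auto intro: d3_swap1 differentiable_partials)

lemma metric_simps [simp]:
  "cost_metric F z $ Inl i $ Inl i' = 0" "cost_metric F z $ Inr j $ Inr j' = 0"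
  "cost_metric F z $ Inl i $ Inr j = - (1/2) * H z i j"
  "cost_metric F z $ Inr j $ Inl i = - (1/2) * partial_deriv (Inr j) (partial_deriv (Inl i) F) z"
  by (simp_all add: cost_metric_def)

lemma metric_RL: "z \<in> U \<Longrightarrow> cost_metric F z $ Inr j $ Inl i = - (1/2) * H z i j"
  by (simp add: d2_swap[of z "Inr j" "Inl i"])

lemma mixed_injective:
  assumes "z \<in> U" "\<And>i. (\<Sum>j\<in>UNIV. H z i j * v $ j) = 0"
  shows "v = 0"
proof -
  have "mixed_hessian F z *v v = 0"
    using assms(2) by (simp add: matrix_vector_mult_def mixed_hessian_def vec_eq_iff)
  then show ?thesis using mixed_invertible[OF assms(1)]
    by (metis invertible_left_inverse matrix_left_invertible_ker)
qed

lemma mixed_injective_transpose: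
  assumes "z \<in> U" "\<And>j. (\<Sum>i\<in>UNIV. H z i j * v $ i) = 0"
  shows "v = 0"
proof -
  have "transpose (mixed_hessian F z) *v v = 0"
    using assms(2) by (simp add: matrix_vector_mult_def mixed_hessian_def transpose_def vec_eq_iff)
  then show ?thesis using transpose_invertible[OF mixed_invertible[OF assms(1)]]
    by (metis invertible_left_inverse matrix_left_invertible_ker)
qed

text \<open>The matrix is block off-diagonal, with blocks \<open>- (1/2)\<close> times
  \<open>H\<close> and its transpose, so a kernel vector splits into a kernel vector of each
  block.\<close>

lemma metric_invertible:
  assumes z: "z \<in> U"
  shows "invertible (cost_metric F z)"
  unfolding invertible_left_inverse matrix_left_invertible_ker
proof (intro allI impI)
  fix v assume "cost_metric F z *v v = 0"
  then have v: "(\<Sum>b\<in>UNIV. cost_metric F z $ a $ b * v $ b) = 0" for a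
    by (simp add: matrix_vector_mult_def vec_eq_iff)
  have "- (1/2) * (\<Sum>j\<in>UNIV. H z i j * pr2 v $ j) = 0" for i
    using v[of "Inl i"] by (simp add: sum_UNIV_Plus sum_distrib_left pr2_def)
  then have "pr2 v = 0" by (intro mixed_injective[OF z]) simp
  moreover have "- (1/2) * (\<Sum>i\<in>UNIV. H z i j * pr1 v $ i) = 0" for j
    using v[of "Inr j"] unfolding sum_UNIV_Plus metric_RL[OF z]
    by (simp add: sum_distrib_left pr1_def)
  then have "pr1 v = 0" by (intro mixed_injective_transpose[OF z]) simp
  moreover have "dsum 0 0 = (0 :: real^('n + 'n))"
    by (simp add: dsum_def vec_eq_iff split: sum.split)
  ultimately show "v = 0" using dsum_pr[of v] by simp
qed

lemma differentiable_metric: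
  assumes "z \<in> U"
  shows "(\<lambda>w. cost_metric F w $ a $ b) differentiable (at z)"
  by (cases a; cases b) (auto intro!: derivative_intros differentiable_partials assms)

lemma partial_metric:
  assumes z: "z \<in> U"
  shows "partial_deriv a (\<lambda>w. cost_metric F w $ Inl i $ Inl i') z = 0"
    "partial_deriv a (\<lambda>w. cost_metric F w $ Inr j $ Inr j') z = 0"
    "partial_deriv a (\<lambda>w. cost_metric F w $ Inl i $ Inr j) z = - (1/2) * d3 a (Inl i) (Inr j) z"
    "partial_deriv a (\<lambda>w. cost_metric F w $ Inr j $ Inl i) z = - (1/2) * d3 a (Inl i) (Inr j) z"
  by (simp_all only: metric_simps partial_deriv_const partial_deriv_cmult differentiable_partials[OF z]
      d3_swap2[OF z, of a "Inr j" "Inl i"])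

lemma differentiable_partial_metric:
  assumes "z \<in> U"
  shows "partial_deriv c (\<lambda>w. cost_metric F w $ a $ b) differentiable (at z)"
proof -
  have D: "(\<lambda>w. - (1/2) * d3 c (Inl i) (Inr j) w) differentiable (at z)" for i j
    by (auto intro!: derivative_intros differentiable_partials assms)
  have tr: "f differentiable (at z)" if "g differentiable (at z)" "\<And>w. w \<in> U \<Longrightarrow> g w = f w" for f g :: "real^('n + 'n) \<Rightarrow> real"
    using that has_derivative_transform_within_open[OF _ open_U assms] by (metis differentiable_def)
  show ?thesis
  proof (cases a; cases b)
    fix i j assume "a = Inl i" "b = Inr j"
    then show ?thesis by (auto intro!: tr[OF D[of i j]] simp: partial_metric simp del: metric_simps)
  next
    fix i j assume "a = Inr j" "b = Inl i"
    then show ?thesis by (auto intro!: tr[OF D[of i j]] simp: partial_metric simp del: metric_simps)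
  qed (auto intro: tr[of "\<lambda>_. 0"])
qed

section \<open>Christoffel symbols of the cost metric\<close>

lemma differentiable_christoffel:
  assumes "z \<in> U"
  shows "\<Gamma> k i j differentiable (at z)"
  unfolding christoffel_def
  by (intro differentiable_mult differentiable_const differentiable_sum ballI finite differentiable_add
      differentiable_diff differentiable_partial_metric assms
      differentiable_matrix_inv[OF open_U assms metric_invertible differentiable_metric])

text \<open>Multiplication by the metric cancels its inverse and leaves the Christoffel symbol of
  the first kind. The symbols below are characterized through such contractions, so the inverse is
  never written out.\<close>

lemma christoffel_lower:
  assumes z: "z \<in> U"
  shows "(\<Sum>k\<in>UNIV. cost_metric F z $ c $ k * \<Gamma> k i j z) =
    1/2 * (partial_deriv i (\<lambda>w. cost_metric F w $ j $ c) z + partial_deriv j (\<lambda>w. cost_metric F w $ i $ c) z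
      - partial_deriv c (\<lambda>w. cost_metric F w $ i $ j) z)"
proof -
  define L where "L c = 1/2 * (partial_deriv i (\<lambda>w. cost_metric F w $ j $ c) z
    + partial_deriv j (\<lambda>w. cost_metric F w $ i $ c) z - partial_deriv c (\<lambda>w. cost_metric F w $ i $ j) z)" for c
  let ?g = "cost_metric F z"
  have "(\<Sum>k\<in>UNIV. ?g $ c $ k * \<Gamma> k i j z) = (\<Sum>k\<in>UNIV. \<Sum>l\<in>UNIV. ?g $ c $ k * matrix_inv ?g $ k $ l * L l)"
    by (simp only: christoffel_def L_def sum_distrib_left mult_ac)
  also have "\<dots> = (\<Sum>l\<in>UNIV. (?g ** matrix_inv ?g) $ c $ l * L l)"
    by (subst sum.swap) (simp only: matrix_matrix_mult_def vec_lambda_beta sum_distrib_right)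
  also have "\<dots> = L c"
    by (simp add: matrix_inv_right_inverse[OF metric_invertible[OF z]] mat_def if_distrib if_distribR cong: if_cong)
  finally show ?thesis by (simp only: L_def)
qed

text \<open>Already the first-kind symbol vanishes: whichever factor \<open>l\<close> belongs to,
  one of the first two terms is the derivative of a zero block, and the other equals the third term
  because third derivatives of the cost are symmetric.\<close>

lemma christoffel_mixed:
  assumes z: "z \<in> U"
  shows "\<Gamma> k (Inl i) (Inr j) z = 0" "\<Gamma> k (Inr j) (Inl i) z = 0"
proof -
  have "partial_deriv (Inl i) (\<lambda>w. cost_metric F w $ Inr j $ l) z
      + partial_deriv (Inr j) (\<lambda>w. cost_metric F w $ Inl i $ l) z
      = partial_deriv l (\<lambda>w. cost_metric F w $ Inl i $ Inr j) z" 
      "partial_deriv l (\<lambda>w. cost_metric F w $ Inl i $ Inr j) z = partial_deriv l (\<lambda>w. cost_metric F w $ Inr j $ Inl i) z" for l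
  proof -
    show "partial_deriv (Inl i) (\<lambda>w. cost_metric F w $ Inr j $ l) z
      + partial_deriv (Inr j) (\<lambda>w. cost_metric F w $ Inl i $ l) z
      = partial_deriv l (\<lambda>w. cost_metric F w $ Inl i $ Inr j) z"
    proof (cases l)
      case (Inl a)
      show ?thesis unfolding Inl partial_metric[OF z]
        using d3_swap1[OF z, of "Inl i" "Inl a" "Inr j"] by simp
    next
      case (Inr b)
      show ?thesis unfolding Inr partial_metric[OF z]
        using d3_swap1[OF z, of "Inr j" "Inl i" "Inr b"] d3_swap2[OF z, of "Inl i" "Inr j" "Inr b"]
          d3_swap1[OF z, of "Inr b" "Inl i" "Inr j"] by simp
    qed
    show "partial_deriv l (\<lambda>w. cost_metric F w $ Inl i $ Inr j) z = partial_deriv l (\<lambda>w. cost_metric F w $ Inr j $ Inl i) z"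
      by (simp only: partial_metric[OF z])
  qed
  then show "\<Gamma> k (Inl i) (Inr j) z = 0" "\<Gamma> k (Inr j) (Inl i) z = 0"
    unfolding christoffel_def by (simp_all only: add.commute diff_self mult_zero_right sum.neutral_const)
qed

text \<open>The first part is total geodesy of the slices with fixed second component: lowering with
  an index of the first factor meets only zero blocks, and \<open>H\<close> is injective. The second
  part is the index form of the affinity of the differential of the cost along the second factor on
  horizontal geodesics.\<close>

lemma christoffel_LL:
  assumes z: "z \<in> U"
  shows "\<Gamma> (Inr k) (Inl i) (Inl j) z = 0"
    and "(\<Sum>m\<in>UNIV. H z m k * \<Gamma> (Inl m) (Inl i) (Inl j) z) = d3 (Inl i) (Inl j) (Inr k) z"
proof -
  have "(\<chi> k. \<Gamma> (Inr k) (Inl i) (Inl j) z) = 0"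
  proof (rule mixed_injective[OF z])
    fix c
    have "- (1/2) * (\<Sum>k\<in>UNIV. H z c k * \<Gamma> (Inr k) (Inl i) (Inl j) z) = 0"
      using christoffel_lower[OF z, of "Inl c" "Inl i" "Inl j"]
      by (simp add: sum_UNIV_Plus partial_metric[OF z] sum_distrib_left del: metric_simps(4))
    then show "(\<Sum>k\<in>UNIV. H z c k * (\<chi> k. \<Gamma> (Inr k) (Inl i) (Inl j) z) $ k) = 0" by simp
  qed
  then show "\<Gamma> (Inr k) (Inl i) (Inl j) z = 0" by (simp add: vec_eq_iff)
  have "(\<Sum>m\<in>UNIV. - (1/2) * H z m k * \<Gamma> (Inl m) (Inl i) (Inl j) z)
    = 1/2 * (- (1/2) * d3 (Inl i) (Inl j) (Inr k) z + - (1/2) * d3 (Inl j) (Inl i) (Inr k) z)"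
    using christoffel_lower[OF z, of "Inr k" "Inl i" "Inl j"]
    unfolding sum_UNIV_Plus metric_RL[OF z] partial_metric[OF z] by simp
  then have "- (1/2) * (\<Sum>m\<in>UNIV. H z m k * \<Gamma> (Inl m) (Inl i) (Inl j) z) = - (1/2) * d3 (Inl i) (Inl j) (Inr k) z"
    unfolding d3_swap1[OF z, of "Inl j"] sum_distrib_left by (simp only: mult.assoc) simp
  then show "(\<Sum>m\<in>UNIV. H z m k * \<Gamma> (Inl m) (Inl i) (Inl j) z) = d3 (Inl i) (Inl j) (Inr k) z" by simp
qed

text \<open>Mirror image of \<open>christoffel_LL\<close>. Here injectivity of the transpose of
  \<open>H\<close> gives the first part, and the second part expresses that the differential along
  the first factor is affine on vertical geodesics.\<close>

lemma christoffel_RR: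
  assumes z: "z \<in> U"
  shows "\<Gamma> (Inl k) (Inr i) (Inr j) z = 0"
    and "(\<Sum>m\<in>UNIV. H z k m * \<Gamma> (Inr m) (Inr i) (Inr j) z) = d3 (Inl k) (Inr i) (Inr j) z"
proof -
  have "(\<chi> k. \<Gamma> (Inl k) (Inr i) (Inr j) z) = 0"
  proof (rule mixed_injective_transpose[OF z])
    fix c
    have "- (1/2) * (\<Sum>k\<in>UNIV. H z k c * \<Gamma> (Inl k) (Inr i) (Inr j) z) = 0"
      using christoffel_lower[OF z, of "Inr c" "Inr i" "Inr j"]
      unfolding sum_UNIV_Plus metric_RL[OF z] partial_metric[OF z] sum_distrib_left
      by (simp add: mult.assoc)
    then show "(\<Sum>k\<in>UNIV. H z k c * (\<chi> k. \<Gamma> (Inl k) (Inr i) (Inr j) z) $ k) = 0" by simp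
  qed
  then show "\<Gamma> (Inl k) (Inr i) (Inr j) z = 0" by (simp add: vec_eq_iff)
  have "(\<Sum>m\<in>UNIV. - (1/2) * H z k m * \<Gamma> (Inr m) (Inr i) (Inr j) z)
    = 1/2 * (- (1/2) * d3 (Inr i) (Inl k) (Inr j) z + - (1/2) * d3 (Inr j) (Inl k) (Inr i) z)"
    using christoffel_lower[OF z, of "Inl k" "Inr i" "Inr j"]
    unfolding sum_UNIV_Plus metric_simps(1-3) partial_metric[OF z] by simp
  then have "- (1/2) * (\<Sum>m\<in>UNIV. H z k m * \<Gamma> (Inr m) (Inr i) (Inr j) z) = - (1/2) * d3 (Inl k) (Inr i) (Inr j) z"
    unfolding d3_swap1[OF z, of "Inr _" "Inl _"] d3_swap2[OF z, of "Inl k" "Inr j" "Inr i"] sum_distrib_left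
    by (simp only: mult.assoc) simp
  then show "(\<Sum>m\<in>UNIV. H z k m * \<Gamma> (Inr m) (Inr i) (Inr j) z) = d3 (Inl k) (Inr i) (Inr j) z" by simp
qed

text \<open>Hence the acceleration of a geodesic in either factor involves only its velocity in that
  factor.\<close>

lemma christoffel_quadratic:
  assumes z: "z \<in> U"
  shows "(\<Sum>i\<in>UNIV. \<Sum>j\<in>UNIV. \<Gamma> (Inl k) i j z * v $ i * v $ j)
      = (\<Sum>i\<in>UNIV. \<Sum>j\<in>UNIV. \<Gamma> (Inl k) (Inl i) (Inl j) z * pr1 v $ i * pr1 v $ j)"
    and "(\<Sum>i\<in>UNIV. \<Sum>j\<in>UNIV. \<Gamma> (Inr k) i j z * v $ i * v $ j)
      = (\<Sum>i\<in>UNIV. \<Sum>j\<in>UNIV. \<Gamma> (Inr k) (Inr i) (Inr j) z * pr2 v $ i * pr2 v $ j)"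
  by (simp_all add: sum_UNIV_Plus christoffel_mixed[OF z] christoffel_LL(1)[OF z] christoffel_RR(1)[OF z]
      pr1_def pr2_def)

section \<open>The cross-curvature in terms of partial derivatives of the cost\<close>

text \<open>By \<open>christoffel_LL\<close> this is the negative of the bracket in the coordinate
  formula for the cross-curvature. Writing it with \<open>\<Gamma>\<close> in place of the inverse
  of \<open>H\<close> gives the form that the geodesic equation produces.\<close>

definition cross_tensor where
  "cross_tensor i k j l z = d4 (Inl i) (Inl k) (Inr j) (Inr l) z
    - (\<Sum>a\<in>UNIV. d3 (Inl a) (Inr j) (Inr l) z * \<Gamma> (Inl a) (Inl i) (Inl k) z)"

text \<open>The product rule applied to an identity on \<open>U\<close>, solved for the terms with a
  derivative of \<open>g\<close>. With \<open>f\<close> an entry of \<open>H\<close> and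
  \<open>g\<close> a Christoffel symbol it avoids differentiating an inverse matrix.\<close>

lemma partial_contraction:
  assumes z: "z \<in> U" and fg: "\<And>m. f m differentiable (at z)" "\<And>m. g m differentiable (at z)"
    and dh: "h differentiable (at z)"
    and eq: "\<And>w. w \<in> U \<Longrightarrow> (\<Sum>m\<in>M. f m w * g m w) = h w" and M: "finite M"
  shows "(\<Sum>m\<in>M. f m z * partial_deriv a (g m) z) = partial_deriv a h z - (\<Sum>m\<in>M. partial_deriv a (f m) z * g m z)"
proof -
  have "partial_deriv a (\<lambda>w. \<Sum>m\<in>M. f m w * g m w) z = partial_deriv a h z"
    by (rule partial_deriv_cong[OF open_U z _ eq]) (auto intro!: derivative_intros fg M)
  then show ?thesis
    by (simp add: partial_deriv_sum partial_deriv_mult fg sum.distrib)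
qed

lemma partial_zero:
  assumes "z \<in> U" "\<And>w. w \<in> U \<Longrightarrow> h w = 0"
  shows "partial_deriv a h z = 0"
  using partial_deriv_cong[OF open_U assms(1), of "\<lambda>_. 0" h] assms(2) by simp

text \<open>For one derivative index in each factor, the vanishing Christoffel symbols remove all
  quadratic terms and one of the two derivatives (\<open>R1\<close>, \<open>R2\<close>). The
  remaining derivative of \<open>\<Gamma>\<close>, contracted with \<open>H\<close>, is a fourth
  derivative of the cost minus a product of a third derivative with \<open>\<Gamma>\<close>.\<close>

lemma riemann_lower:
  assumes z: "z \<in> U"
  shows "(\<Sum>m\<in>UNIV. cost_metric F z $ m $ Inr k * riemann (cost_metric F) m (Inl l) (Inl i) (Inr j) z)
      = 1/2 * cross_tensor i l j k z"
    and "(\<Sum>m\<in>UNIV. cost_metric F z $ m $ Inl k * riemann (cost_metric F) m (Inr l) (Inl i) (Inr j) z)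
      = - (1/2) * cross_tensor i k j l z"
proof -
  have R1: "riemann (cost_metric F) m (Inl l) (Inl i) (Inr j) z = - partial_deriv (Inr j) (\<Gamma> m (Inl i) (Inl l)) z" for m
    using z by (simp add: riemann_def sum_UNIV_Plus christoffel_mixed christoffel_LL(1) partial_zero)
  have R2: "riemann (cost_metric F) m (Inr l) (Inl i) (Inr j) z = partial_deriv (Inl i) (\<Gamma> m (Inr j) (Inr l)) z" for m
    using z by (simp add: riemann_def sum_UNIV_Plus christoffel_mixed christoffel_RR(1) partial_zero)
  have "(\<Sum>m\<in>UNIV. cost_metric F z $ m $ Inr k * riemann (cost_metric F) m (Inl l) (Inl i) (Inr j) z)
     = 1/2 * (\<Sum>m\<in>UNIV. H z m k * partial_deriv (Inr j) (\<Gamma> (Inl m) (Inl i) (Inl l)) z)"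
    by (simp add: sum_UNIV_Plus R1 sum_distrib_left)
  also have "(\<Sum>m\<in>UNIV. H z m k * partial_deriv (Inr j) (\<Gamma> (Inl m) (Inl i) (Inl l)) z)
     = d4 (Inr j) (Inl i) (Inl l) (Inr k) z
       - (\<Sum>m\<in>UNIV. d3 (Inr j) (Inl m) (Inr k) z * \<Gamma> (Inl m) (Inl i) (Inl l) z)"
    by (rule partial_contraction[OF z])
      (auto intro: differentiable_partials differentiable_christoffel christoffel_LL(2) z)
  also have "\<dots> = cross_tensor i l j k z"
    unfolding cross_tensor_def d4_swap1[OF z, of "Inr j"] d4_swap2[OF z, of _ "Inr j"] d3_swap1[OF z, of "Inr j"] ..
  finally show "(\<Sum>m\<in>UNIV. cost_metric F z $ m $ Inr k * riemann (cost_metric F) m (Inl l) (Inl i) (Inr j) z)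
      = 1/2 * cross_tensor i l j k z" .
  have "(\<Sum>m\<in>UNIV. cost_metric F z $ m $ Inl k * riemann (cost_metric F) m (Inr l) (Inl i) (Inr j) z)
     = - (1/2) * (\<Sum>m\<in>UNIV. H z k m * partial_deriv (Inl i) (\<Gamma> (Inr m) (Inr j) (Inr l)) z)"
    unfolding sum_UNIV_Plus R2 metric_RL[OF z] by (simp add: sum_distrib_left)
  also have "(\<Sum>m\<in>UNIV. H z k m * partial_deriv (Inl i) (\<Gamma> (Inr m) (Inr j) (Inr l)) z)
     = d4 (Inl i) (Inl k) (Inr j) (Inr l) z
       - (\<Sum>m\<in>UNIV. d3 (Inl i) (Inl k) (Inr m) z * \<Gamma> (Inr m) (Inr j) (Inr l) z)"
    by (rule partial_contraction[OF z])
      (auto intro: differentiable_partials differentiable_christoffel christoffel_RR(2) z)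
  \<comment> \<open>The correction appears with the Christoffel symbol of the second factor. Both
    third derivatives are \<open>H\<close> contracted with a symbol, so one factor \<open>H\<close>
    can be moved from one symbol to the other.\<close>
  also have "(\<Sum>m\<in>UNIV. d3 (Inl i) (Inl k) (Inr m) z * \<Gamma> (Inr m) (Inr j) (Inr l) z)
     = (\<Sum>m\<in>UNIV. \<Sum>a\<in>UNIV. H z a m * \<Gamma> (Inl a) (Inl i) (Inl k) z * \<Gamma> (Inr m) (Inr j) (Inr l) z)"
    by (simp add: christoffel_LL(2)[OF z, symmetric] sum_distrib_right)
  also have "\<dots> = (\<Sum>a\<in>UNIV. (\<Sum>m\<in>UNIV. H z a m * \<Gamma> (Inr m) (Inr j) (Inr l) z) * \<Gamma> (Inl a) (Inl i) (Inl k) z)"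
    by (subst sum.swap) (simp only: sum_distrib_left sum_distrib_right mult_ac)
  also have "\<dots> = (\<Sum>a\<in>UNIV. d3 (Inl a) (Inr j) (Inr l) z * \<Gamma> (Inl a) (Inl i) (Inl k) z)"
    by (simp add: christoffel_RR(2)[OF z])
  finally show "(\<Sum>m\<in>UNIV. cost_metric F z $ m $ Inl k * riemann (cost_metric F) m (Inr l) (Inl i) (Inr j) z)
      = - (1/2) * cross_tensor i k j l z" by (simp only: cross_tensor_def)
qed

text \<open>The bivector has only mixed entries. The two orders of the second index pair contribute
  one half each to \<open>T\<close>, with a minus sign, and the two orders of the first pair
  contribute equally; together this makes the constant \<open>- 2\<close>.\<close>

lemma curvature_operator_cross:
  assumes z: "z \<in> U"
  shows "curvature_operator (cost_metric F) z (wedge (dsum p 0) (dsum 0 q)) (wedge (dsum p 0) (dsum 0 q))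
    = - 2 * (\<Sum>j\<in>UNIV. \<Sum>l\<in>UNIV. (q $ j * q $ l) * (\<Sum>i\<in>UNIV. \<Sum>k\<in>UNIV. cross_tensor i k j l z * p $ i * p $ k))"
proof -
  define W where "W = wedge (dsum p 0) (dsum 0 q)"
  define S where "S k l i j = (\<Sum>m\<in>UNIV. cost_metric F z $ m $ k * riemann (cost_metric F) m l i j z)" for k l i j
  define T where "T i j = (\<Sum>k\<in>UNIV. \<Sum>l\<in>UNIV. S k l i j * W $ k $ l)" for i j
  have W: "W $ Inl i $ Inl i' = 0" "W $ Inr j $ Inr j' = 0"
    "W $ Inl i $ Inr j = p $ i * q $ j" "W $ Inr j $ Inl i = - (p $ i * q $ j)" for i i' j j'
    by (simp_all add: W_def wedge_def)
  have S: "S k l j i = - S k l i j" for k l i j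
    by (simp add: S_def riemann_antisym[of _ _ _ j i] sum_negf)
  have T: "T j i = - T i j" for i j
    by (simp add: T_def S[of _ _ j i] sum_negf)
  have S_lower: "S (Inr k) (Inl l) (Inl i) (Inr j) = 1/2 * cross_tensor i l j k z"
    "S (Inl k) (Inr l) (Inl i) (Inr j) = - (1/2) * cross_tensor i k j l z" for i j k l
    unfolding S_def by (rule riemann_lower[OF z])+
  have TLR: "T (Inl i) (Inr j) = - (\<Sum>k\<in>UNIV. \<Sum>l\<in>UNIV. cross_tensor i k j l z * p $ k * q $ l)" for i j
  proof -
    have "T (Inl i) (Inr j) = (\<Sum>k\<in>UNIV. \<Sum>l\<in>UNIV. - (1/2) * cross_tensor i k j l z * (p $ k * q $ l))
        + (\<Sum>k\<in>UNIV. \<Sum>l\<in>UNIV. - (1/2) * cross_tensor i l j k z * (p $ l * q $ k))"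
      unfolding T_def sum_UNIV_Plus W S_lower by simp
    also have "(\<Sum>k\<in>UNIV. \<Sum>l\<in>UNIV. - (1/2) * cross_tensor i l j k z * (p $ l * q $ k))
        = (\<Sum>k\<in>UNIV. \<Sum>l\<in>UNIV. - (1/2) * cross_tensor i k j l z * (p $ k * q $ l))"
      by (rule sum.swap)
    also have "(\<Sum>k\<in>UNIV. \<Sum>l\<in>UNIV. - (1/2) * cross_tensor i k j l z * (p $ k * q $ l))
        = - (1/2) * (\<Sum>k\<in>UNIV. \<Sum>l\<in>UNIV. cross_tensor i k j l z * p $ k * q $ l)"
      by (simp only: sum_distrib_left mult.assoc)
    finally show ?thesis by simp
  qed
  have "curvature_operator (cost_metric F) z W W = (\<Sum>i\<in>UNIV. \<Sum>j\<in>UNIV. W $ i $ j * T i j)"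
    unfolding curvature_operator_def T_def S_def[symmetric] sum_distrib_left by (simp only: mult_ac)
  \<comment> \<open>Exchanging the two indices changes the sign of both \<open>W\<close> and
    \<open>T\<close>, so the second block repeats the first.\<close>
  also have "\<dots> = (\<Sum>i\<in>UNIV. \<Sum>j\<in>UNIV. (p $ i * q $ j) * T (Inl i) (Inr j))
      + (\<Sum>j\<in>UNIV. \<Sum>i\<in>UNIV. (p $ i * q $ j) * T (Inl i) (Inr j))"
    by (simp add: sum_UNIV_Plus W T[of "Inr _" "Inl _"])
  also have "(\<Sum>j\<in>UNIV. \<Sum>i\<in>UNIV. (p $ i * q $ j) * T (Inl i) (Inr j))
      = (\<Sum>i\<in>UNIV. \<Sum>j\<in>UNIV. (p $ i * q $ j) * T (Inl i) (Inr j))"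
    by (rule sum.swap)
  also have "(\<Sum>i\<in>UNIV. \<Sum>j\<in>UNIV. (p $ i * q $ j) * T (Inl i) (Inr j))
    = - (\<Sum>i\<in>UNIV. \<Sum>j\<in>UNIV. \<Sum>k\<in>UNIV. \<Sum>l\<in>UNIV. (q $ j * q $ l) * (cross_tensor i k j l z * p $ i * p $ k))"
    by (simp only: TLR sum_distrib_left sum_negf mult_minus_right mult_ac)
  also have "(\<Sum>i\<in>UNIV. \<Sum>j\<in>UNIV. \<Sum>k\<in>UNIV. \<Sum>l\<in>UNIV. (q $ j * q $ l) * (cross_tensor i k j l z * p $ i * p $ k))
    = (\<Sum>j\<in>UNIV. \<Sum>i\<in>UNIV. \<Sum>l\<in>UNIV. \<Sum>k\<in>UNIV. (q $ j * q $ l) * (cross_tensor i k j l z * p $ i * p $ k))"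
    by (subst sum.swap) (intro sum.cong refl sum.swap)
  also have "\<dots> = (\<Sum>j\<in>UNIV. \<Sum>l\<in>UNIV. (q $ j * q $ l) * (\<Sum>i\<in>UNIV. \<Sum>k\<in>UNIV. cross_tensor i k j l z * p $ i * p $ k))"
    unfolding sum_distrib_left by (intro sum.cong refl sum.swap)
  finally show ?thesis by (simp add: W_def)
qed

section \<open>Second derivative along the second factor and its variation along the first\<close>

text \<open>The overview's \<open>G\<close> in a product chart: the second derivative of the cost
  when the second component moves with velocity \<open>q\<close> and acceleration
  \<open>\<rho>\<close> while the first stays fixed. Both vectors are constants, so that this is a
  function of the point.\<close>

definition slice_hessian where
  "slice_hessian q \<rho> z = (\<Sum>k\<in>UNIV. \<Sum>l\<in>UNIV. (q $ k * q $ l) * partial_deriv (Inr k) (partial_deriv (Inr l) F) z)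
     + (\<Sum>k\<in>UNIV. \<rho> $ k * partial_deriv (Inr k) F z)"

definition slice_hessian_deriv where
  "slice_hessian_deriv q \<rho> z v = (\<Sum>k\<in>UNIV. \<Sum>l\<in>UNIV. (q $ k * q $ l) * (\<Sum>i\<in>UNIV. d3 (Inl i) (Inr k) (Inr l) z * v $ i))
     + (\<Sum>k\<in>UNIV. \<rho> $ k * (\<Sum>i\<in>UNIV. H z i k * v $ i))"

text \<open>For a geodesic acceleration \<open>\<rho>\<close>, contraction with \<open>H\<close>
  turns the Christoffel symbols into third derivatives (\<open>christoffel_RR\<close>), which cancel
  the first sum. This is the affinity of \<open>Dc\<close> along the vertical geodesic, tested
  against \<open>v\<close>.\<close>

lemma slice_hessian_deriv_geodesic:
  assumes z: "z \<in> U"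
    and \<rho>: "\<And>k. \<rho> $ k = - (\<Sum>i\<in>UNIV. \<Sum>j\<in>UNIV. \<Gamma> (Inr k) (Inr i) (Inr j) z * q $ i * q $ j)"
  shows "slice_hessian_deriv q \<rho> z v = 0"
proof -
  have "(\<Sum>k\<in>UNIV. \<rho> $ k * (\<Sum>i\<in>UNIV. H z i k * v $ i)) = (\<Sum>i\<in>UNIV. v $ i * (\<Sum>k\<in>UNIV. H z i k * \<rho> $ k))"
    unfolding sum_distrib_left by (subst sum.swap) (simp only: mult_ac)
  also have "\<dots> = (\<Sum>i\<in>UNIV. v $ i * - (\<Sum>a\<in>UNIV. \<Sum>b\<in>UNIV. (q $ a * q $ b) * d3 (Inl i) (Inr a) (Inr b) z))"
  proof (intro sum.cong refl arg_cong2[where f="(*)"])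
    fix i
    have "(\<Sum>k\<in>UNIV. H z i k * \<rho> $ k)
      = - (\<Sum>k\<in>UNIV. \<Sum>a\<in>UNIV. \<Sum>b\<in>UNIV. (q $ a * q $ b) * (H z i k * \<Gamma> (Inr k) (Inr a) (Inr b) z))"
      by (simp only: \<rho> sum_distrib_left mult_minus_right sum_negf mult_ac)
    also have "(\<Sum>k\<in>UNIV. \<Sum>a\<in>UNIV. \<Sum>b\<in>UNIV. (q $ a * q $ b) * (H z i k * \<Gamma> (Inr k) (Inr a) (Inr b) z))
      = (\<Sum>a\<in>UNIV. \<Sum>b\<in>UNIV. \<Sum>k\<in>UNIV. (q $ a * q $ b) * (H z i k * \<Gamma> (Inr k) (Inr a) (Inr b) z))"
      by (subst sum.swap) (intro sum.cong refl sum.swap)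
    finally show "(\<Sum>k\<in>UNIV. H z i k * \<rho> $ k)
      = - (\<Sum>a\<in>UNIV. \<Sum>b\<in>UNIV. (q $ a * q $ b) * d3 (Inl i) (Inr a) (Inr b) z)"
      by (simp only: christoffel_RR(2)[OF z, symmetric] sum_distrib_left)
  qed
  also have "\<dots> = - (\<Sum>i\<in>UNIV. \<Sum>a\<in>UNIV. \<Sum>b\<in>UNIV. (q $ a * q $ b) * (d3 (Inl i) (Inr a) (Inr b) z * v $ i))"
    by (simp only: sum_distrib_left mult_minus_right sum_negf mult_ac)
  also have "(\<Sum>i\<in>UNIV. \<Sum>a\<in>UNIV. \<Sum>b\<in>UNIV. (q $ a * q $ b) * (d3 (Inl i) (Inr a) (Inr b) z * v $ i))
     = (\<Sum>a\<in>UNIV. \<Sum>b\<in>UNIV. \<Sum>i\<in>UNIV. (q $ a * q $ b) * (d3 (Inl i) (Inr a) (Inr b) z * v $ i))"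
    by (subst sum.swap) (intro sum.cong refl sum.swap)
  finally show ?thesis by (simp only: slice_hessian_deriv_def sum_distrib_left add.right_inverse)
qed

text \<open>Used with \<open>h\<close> a column of \<open>H\<close>, where the inner sum becomes a
  third derivative of the cost, and with \<open>h\<close> a third derivative, where it becomes the
  correction in \<open>cross_tensor\<close>.\<close>

lemma contract_geodesic_acceleration:
  assumes "\<And>m. a $ m = - (\<Sum>i\<in>UNIV. \<Sum>j\<in>UNIV. \<Gamma> (Inl m) (Inl i) (Inl j) z * v $ i * v $ j)"
  shows "(\<Sum>m\<in>UNIV. h m * a $ m)
    = - (\<Sum>i\<in>UNIV. \<Sum>j\<in>UNIV. (\<Sum>m\<in>UNIV. h m * \<Gamma> (Inl m) (Inl i) (Inl j) z) * v $ i * v $ j)"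
proof -
  have "(\<Sum>m\<in>UNIV. h m * a $ m)
    = - (\<Sum>m\<in>UNIV. \<Sum>i\<in>UNIV. \<Sum>j\<in>UNIV. h m * \<Gamma> (Inl m) (Inl i) (Inl j) z * v $ i * v $ j)"
    by (simp only: assms sum_distrib_left mult_minus_right sum_negf mult.assoc)
  also have "(\<Sum>m\<in>UNIV. \<Sum>i\<in>UNIV. \<Sum>j\<in>UNIV. h m * \<Gamma> (Inl m) (Inl i) (Inl j) z * v $ i * v $ j)
    = (\<Sum>i\<in>UNIV. \<Sum>j\<in>UNIV. \<Sum>m\<in>UNIV. h m * \<Gamma> (Inl m) (Inl i) (Inl j) z * v $ i * v $ j)"
    by (subst sum.swap) (intro sum.cong refl sum.swap)
  finally show ?thesis by (simp only: sum_distrib_right)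
qed

text \<open>Differentiating a second partial along the second factor twice along a horizontal
  geodesic gives a fourth derivative plus an acceleration term, which together are
  \<open>cross_tensor\<close>. The terms with \<open>\<rho>\<close> contribute nothing.\<close>

lemma has_deriv2_slice_hessian:
  assumes s: "s \<in> {0..1}"
    and \<zeta>: "\<forall>\<^sub>F r in nhds s. r \<in> {0..1} \<longrightarrow> dsum (\<zeta> r) w \<in> U \<and> (\<zeta> has_vector_derivative v r) (at r within {0..1})"
    and v: "(v has_vector_derivative a) (at s within {0..1})"
    and a: "\<And>m. a $ m = - (\<Sum>i\<in>UNIV. \<Sum>j\<in>UNIV. \<Gamma> (Inl m) (Inl i) (Inl j) (dsum (\<zeta> s) w) * v s $ i * v s $ j)"
  shows "has_deriv2 (\<lambda>r. slice_hessian q \<rho> (dsum (\<zeta> r) w)) (\<lambda>r. slice_hessian_deriv q \<rho> (dsum (\<zeta> r) w) (v r))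
    (\<Sum>k\<in>UNIV. \<Sum>l\<in>UNIV. (q $ k * q $ l) *
      (\<Sum>i\<in>UNIV. \<Sum>j\<in>UNIV. cross_tensor i j k l (dsum (\<zeta> s) w) * v s $ i * v s $ j)) s"
proof -
  define z where "z = dsum (\<zeta> s) w"
  have z: "z \<in> U" using eventually_nhds_x_imp_x[OF \<zeta>] s by (simp add: z_def)
  have E2: "has_deriv2 (\<lambda>r. partial_deriv (Inr k) (partial_deriv (Inr l) F) (dsum (\<zeta> r) w))
      (\<lambda>r. \<Sum>i\<in>UNIV. d3 (Inl i) (Inr k) (Inr l) (dsum (\<zeta> r) w) * v r $ i)
      (\<Sum>i\<in>UNIV. \<Sum>j\<in>UNIV. cross_tensor i j k l z * v s $ i * v s $ j) s" for k l
  proof -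
    have "(\<Sum>i\<in>UNIV. \<Sum>j\<in>UNIV. d4 (Inl j) (Inl i) (Inr k) (Inr l) z * v s $ j * v s $ i)
        + (\<Sum>i\<in>UNIV. d3 (Inl i) (Inr k) (Inr l) z * a $ i)
      = (\<Sum>i\<in>UNIV. \<Sum>j\<in>UNIV. cross_tensor i j k l z * v s $ i * v s $ j)"
      unfolding contract_geodesic_acceleration[OF a[folded z_def]] cross_tensor_def
      by (subst sum.swap) (simp add: left_diff_distrib sum_subtractf)
    with has_deriv2_left[OF C2 s \<zeta> v, of "Inr k" "Inr l"] show ?thesis by (simp add: z_def)
  qed
  \<comment> \<open>The zero is the affinity of the differential along the second factor on
    horizontal geodesics; it makes the result independent of \<open>\<rho>\<close>.\<close>
  have E1: "has_deriv2 (\<lambda>r. partial_deriv (Inr k) F (dsum (\<zeta> r) w))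
      (\<lambda>r. \<Sum>i\<in>UNIV. H (dsum (\<zeta> r) w) i k * v r $ i) 0 s" for k
  proof -
    have "(\<Sum>i\<in>UNIV. \<Sum>j\<in>UNIV. d3 (Inl j) (Inl i) (Inr k) z * v s $ j * v s $ i)
        + (\<Sum>i\<in>UNIV. H z i k * a $ i) = 0"
      unfolding contract_geodesic_acceleration[OF a[folded z_def]] christoffel_LL(2)[OF z]
      by (subst sum.swap) simp
    with has_deriv2_left[OF Ck_on_mono[OF C3] s \<zeta> v, of "Inr k"] show ?thesis by (simp add: z_def)
  qed
  have "has_deriv2 (\<lambda>r. slice_hessian q \<rho> (dsum (\<zeta> r) w)) (\<lambda>r. slice_hessian_deriv q \<rho> (dsum (\<zeta> r) w) (v r))
    ((\<Sum>k\<in>UNIV. \<Sum>l\<in>UNIV. (q $ k * q $ l) *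
      (\<Sum>i\<in>UNIV. \<Sum>j\<in>UNIV. cross_tensor i j k l z * v s $ i * v s $ j)) + (\<Sum>k\<in>UNIV. \<rho> $ k * 0)) s"
    unfolding slice_hessian_def slice_hessian_deriv_def
    by (intro has_deriv2_add has_deriv2_sum has_deriv2_cmult E1 E2 finite)
  then show ?thesis by (simp add: z_def)
qed

lemma has_deriv2_vertical:
  assumes s: "s \<in> {0..1}"
    and \<zeta>: "\<forall>\<^sub>F r in nhds s. r \<in> {0..1} \<longrightarrow> dsum u (\<zeta> r) \<in> U \<and> (\<zeta> has_vector_derivative v r) (at r within {0..1})"
    and v: "(v has_vector_derivative a) (at s within {0..1})"
  shows "\<exists>f'. has_deriv2 (\<lambda>r. F (dsum u (\<zeta> r))) f' (slice_hessian (v s) a (dsum u (\<zeta> s))) s"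
proof -
  have "(\<Sum>i\<in>UNIV. \<Sum>j\<in>UNIV. partial_deriv (Inr j) (partial_deriv (Inr i) F) (dsum u (\<zeta> s)) * v s $ j * v s $ i)
      + (\<Sum>i\<in>UNIV. partial_deriv (Inr i) F (dsum u (\<zeta> s)) * a $ i) = slice_hessian (v s) a (dsum u (\<zeta> s))"
    unfolding slice_hessian_def by (subst sum.swap) (simp only: mult_ac)
  with has_deriv2_right[OF Ck_on_mono[OF C4] s \<zeta> v] show ?thesis by fastforce
qed

text \<open>Only partials in the second factor occur in \<open>slice_hessian\<close>, so it can be
  computed after freezing the first component. This is what later removes the chart of the first
  factor.\<close>

lemma slice_hessian_eq_partial:
  assumes z: "dsum u w \<in> U"
  shows "slice_hessian q \<rho> (dsum u w)
    = (\<Sum>k\<in>UNIV. \<Sum>l\<in>UNIV. (q $ k * q $ l) * partial_deriv k (partial_deriv l (\<lambda>w. F (dsum u w))) w)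
      + (\<Sum>k\<in>UNIV. \<rho> $ k * partial_deriv k (\<lambda>w. F (dsum u w)) w)"
proof -
  define V where "V = {w. dsum u w \<in> U}"
  have V: "open V"
  proof -
    have "continuous_on UNIV (\<lambda>w. dsum u 0 + dsum 0 w)"
      by (intro continuous_intros linear_continuous_on bounded_linear_dsum_right)
    then show ?thesis
      using open_vimage[OF open_U, of "\<lambda>w. dsum u w"] by (simp add: V_def vimage_def flip: dsum_split)
  qed
  have one: "partial_deriv k (\<lambda>w. F (dsum u w)) w' = partial_deriv (Inr k) F (dsum u w')" if "w' \<in> V" for k w'
    using partial_deriv_slice(1)[of F] Ck_on_differentiable[OF C4] that by (simp add: V_def)
  have "partial_deriv k (partial_deriv l (\<lambda>w. F (dsum u w))) w
      = partial_deriv (Inr k) (partial_deriv (Inr l) F) (dsum u w)" for k l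
  proof -
    have D: "partial_deriv (Inr l) F differentiable (at (dsum u w))" by (rule differentiable_partials[OF z])
    have "partial_deriv k (\<lambda>w. partial_deriv (Inr l) F (dsum u w)) w = partial_deriv k (partial_deriv l (\<lambda>w. F (dsum u w))) w"
      by (rule partial_deriv_cong[OF V]) (use z one partial_deriv_slice(2)[OF D] in \<open>auto simp: V_def\<close>)
    then show ?thesis using partial_deriv_slice(1)[OF D] by simp
  qed
  then show ?thesis using one z by (simp add: slice_hessian_def V_def)
qed

end

section \<open>Horizontal and vertical geodesics\<close>

lemma chart_inv_left: "is_chart \<phi> \<Longrightarrow> x \<in> fst \<phi> \<Longrightarrow> chart_inv \<phi> (snd \<phi> x) = x"
  unfolding is_chart_def homeomorphism_def by blast

text \<open>The image is the preimage of \<open>N\<close> under the inverse charts, which are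
  continuous on the open product of the chart images.\<close>

lemma open_coords_image:
  fixes \<phi> :: "('a::topological_space, 'n::finite) chart" and \<psi> :: "('b::topological_space, 'n) chart"
  assumes \<phi>: "is_chart \<phi>" and \<psi>: "is_chart \<psi>" and N: "open N"
  shows "open (coords \<phi> \<psi> ` (N \<inter> fst \<phi> \<times> fst \<psi>))"
proof -
  let ?S = "{z. pr1 z \<in> snd \<phi> ` fst \<phi>} \<inter> {z. pr2 z \<in> snd \<psi> ` fst \<psi>}"
  let ?f = "\<lambda>z. (chart_inv \<phi> (pr1 z), chart_inv \<psi> (pr2 z))"
  have "open ?S"
    using \<phi> \<psi> open_vimage[of "snd \<phi> ` fst \<phi>" pr1] open_vimage[of "snd \<psi> ` fst \<psi>" pr2]
    by (auto simp: is_chart_def vimage_def intro!: open_Int linear_continuous_on bounded_linear_pr1 bounded_linear_pr2)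
  moreover have "continuous_on ?S ?f"
  proof (intro continuous_on_Pair)
    have "continuous_on (snd \<phi> ` fst \<phi>) (chart_inv \<phi>)" "continuous_on (snd \<psi> ` fst \<psi>) (chart_inv \<psi>)"
      using \<phi> \<psi> by (auto simp: is_chart_def homeomorphism_def)
    then show "continuous_on ?S (\<lambda>z. chart_inv \<phi> (pr1 z))" "continuous_on ?S (\<lambda>z. chart_inv \<psi> (pr2 z))"
      by (auto intro: continuous_on_compose2[OF _ linear_continuous_on[OF bounded_linear_pr1]]
          continuous_on_compose2[OF _ linear_continuous_on[OF bounded_linear_pr2]])
  qed
  ultimately have "open (?S \<inter> ?f -` N)" using N by (intro continuous_open_preimage)
  moreover have "coords \<phi> \<psi> ` (N \<inter> fst \<phi> \<times> fst \<psi>) = ?S \<inter> ?f -` N"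
  proof (intro equalityI subsetI)
    fix z assume "z \<in> coords \<phi> \<psi> ` (N \<inter> fst \<phi> \<times> fst \<psi>)"
    then show "z \<in> ?S \<inter> ?f -` N" by (auto simp: coords_def chart_inv_left \<phi> \<psi>)
  next
    fix z assume z: "z \<in> ?S \<inter> ?f -` N"
    then obtain x y where xy: "x \<in> fst \<phi>" "pr1 z = snd \<phi> x" "y \<in> fst \<psi>" "pr2 z = snd \<psi> y" by auto
    then have "(x, y) \<in> N" using z by (auto simp: chart_inv_left \<phi> \<psi>)
    moreover have "z = coords \<phi> \<psi> (x, y)" using dsum_pr[of z] xy by (simp add: coords_def)
    ultimately show "z \<in> coords \<phi> \<psi> ` (N \<inter> fst \<phi> \<times> fst \<psi>)" using xy by auto
  qed
  ultimately show ?thesis by simp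
qed

lemma curve_eventually_in_open:
  fixes \<gamma> :: "real \<Rightarrow> 'a::topological_space"
  assumes "continuous_on S \<gamma>" "s \<in> S" "open W" "\<gamma> s \<in> W"
  shows "\<forall>\<^sub>F r in nhds s. r \<in> S \<longrightarrow> \<gamma> r \<in> W"
proof -
  have "\<forall>\<^sub>F r in at s within S. \<gamma> r \<in> W"
    using assms(1,2) by (intro topological_tendstoD[OF _ assms(3,4)]) (simp add: continuous_on_def)
  then show ?thesis unfolding eventually_at_filter
    by eventually_elim (use assms(4) in auto)
qed

lemma h_geodesicD:
  assumes "h_geodesic A B N c \<gamma>"
  shows "continuous_on {0..1} \<gamma>" "t \<in> {0..1} \<Longrightarrow> \<gamma> t \<in> N"
    "\<phi> \<in> A \<Longrightarrow> \<psi> \<in> B \<Longrightarrow> \<exists>v. \<forall>t\<in>{0..1}. \<gamma> t \<in> fst \<phi> \<times> fst \<psi> \<longrightarrow>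
        ((\<lambda>s. coords \<phi> \<psi> (\<gamma> s)) has_vector_derivative v t) (at t within {0..1}) \<and>
        (v has_vector_derivative
          (\<chi> k. - (\<Sum>i\<in>UNIV. \<Sum>j\<in>UNIV.
             christoffel (cost_metric (local_cost c \<phi> \<psi>)) k i j (coords \<phi> \<psi> (\<gamma> t)) * v t $ i * v t $ j)))
          (at t within {0..1})"
proof -
  note * = assms[unfolded h_geodesic_def]
  show "continuous_on {0..1} \<gamma>" using * by (rule conjunct1)
  show "t \<in> {0..1} \<Longrightarrow> \<gamma> t \<in> N" using *[THEN conjunct2, THEN conjunct1] by (rule subsetD[OF _ imageI])
  show "\<phi> \<in> A \<Longrightarrow> \<psi> \<in> B \<Longrightarrow> \<exists>v. \<forall>t\<in>{0..1}. \<gamma> t \<in> fst \<phi> \<times> fst \<psi> \<longrightarrow>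
        ((\<lambda>s. coords \<phi> \<psi> (\<gamma> s)) has_vector_derivative v t) (at t within {0..1}) \<and>
        (v has_vector_derivative
          (\<chi> k. - (\<Sum>i\<in>UNIV. \<Sum>j\<in>UNIV.
             christoffel (cost_metric (local_cost c \<phi> \<psi>)) k i j (coords \<phi> \<psi> (\<gamma> t)) * v t $ i * v t $ j)))
          (at t within {0..1})"
    by (rule *[THEN conjunct2, THEN conjunct2, THEN bspec, THEN bspec])
qed

section \<open>From product coordinates to the manifolds\<close>

locale cross_curved_cost =
  fixes A :: "('a::{t2_space,second_countable_topology}, 'n::finite) chart set"
    and B :: "('b::{t2_space,second_countable_topology}, 'n) chart set"
    and N :: "('a \<times> 'b) set"
    and c :: "'a \<times> 'b \<Rightarrow> real"
  assumes atlas_A: "smooth_atlas A" and atlas_B: "smooth_atlas B"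
    and open_N: "open N" and C4_cost: "Ck_cost_on 4 A B N c"
    and nondeg: "non_degenerate A B N c" and nonneg_cross: "nonneg_cross_curved A B N c"
begin

abbreviation "domain \<phi> \<psi> \<equiv> coords \<phi> \<psi> ` (N \<inter> fst \<phi> \<times> fst \<psi>)"

lemma charts: "\<phi> \<in> A \<Longrightarrow> is_chart \<phi>" "\<psi> \<in> B \<Longrightarrow> is_chart \<psi>"
  using atlas_A atlas_B by (auto simp: smooth_atlas_def)

lemma obtain_charts:
  obtains \<phi> \<psi> where "\<phi> \<in> A" "x \<in> fst \<phi>" "\<psi> \<in> B" "xb \<in> fst \<psi>"
proof -
  have "x \<in> (\<Union>\<phi>\<in>A. fst \<phi>)" "xb \<in> (\<Union>\<psi>\<in>B. fst \<psi>)"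
    using atlas_A atlas_B by (auto simp: smooth_atlas_def)
  then show thesis using that by blast
qed

lemma cost_domain:
  assumes "\<phi> \<in> A" "\<psi> \<in> B"
  shows "cost_domain (local_cost c \<phi> \<psi>) (domain \<phi> \<psi>)"
proof
  show "open (domain \<phi> \<psi>)" by (intro open_coords_image charts assms open_N)
  show "Ck_on 4 (domain \<phi> \<psi>) (local_cost c \<phi> \<psi>)"
    using C4_cost assms by (auto simp: Ck_cost_on_def)
  show "invertible (mixed_hessian (local_cost c \<phi> \<psi>) z)" if "z \<in> domain \<phi> \<psi>" for z
    using that nondeg assms unfolding non_degenerate_def by blast
qed

text \<open>The second derivative of \<open>c (y, _)\<close> along a curve with velocity \<open>q\<close> and acceleration \<open>\<rho>\<close>
  at the point with coordinates \<open>w\<close>. No chart of the first factor enters, so that its values can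
  be compared along a horizontal geodesic leaving every single chart.\<close>

definition fibre_hessian where
  "fibre_hessian \<psi> q \<rho> w y =
     (\<Sum>k\<in>UNIV. \<Sum>l\<in>UNIV. (q $ k * q $ l) * partial_deriv k (partial_deriv l (\<lambda>w. c (y, chart_inv \<psi> w))) w)
     + (\<Sum>k\<in>UNIV. \<rho> $ k * partial_deriv k (\<lambda>w. c (y, chart_inv \<psi> w)) w)"

lemma slice_hessian_eq_fibre_hessian:
  assumes \<phi>: "\<phi> \<in> A" "y \<in> fst \<phi>" and \<psi>: "\<psi> \<in> B" "xb \<in> fst \<psi>" and N: "(y, xb) \<in> N"
  shows "cost_domain.slice_hessian (local_cost c \<phi> \<psi>) q \<rho> (dsum (snd \<phi> y) (snd \<psi> xb))
    = fibre_hessian \<psi> q \<rho> (snd \<psi> xb) y"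
proof -
  interpret cost_domain "local_cost c \<phi> \<psi>" "domain \<phi> \<psi>" by (rule cost_domain[OF \<phi>(1) \<psi>(1)])
  have "coords \<phi> \<psi> (y, xb) \<in> domain \<phi> \<psi>" using assms by blast
  then have "dsum (snd \<phi> y) (snd \<psi> xb) \<in> domain \<phi> \<psi>" by (simp add: coords_def)
  from slice_hessian_eq_partial[OF this] show ?thesis
    by (simp add: fibre_hessian_def local_cost_def chart_inv_left charts \<phi>)
qed

text \<open>The first derivative is expressed in the chart \<open>\<phi>\<close> around
  \<open>fst (\<gamma> s)\<close>, whereas the function differentiated does not involve
  \<open>\<phi>\<close>; different charts may therefore serve different \<open>s\<close>. The second
  derivative \<open>b\<close> is minus one half of the cross-curvature.\<close>

lemma horizontal_geodesic:
  assumes geo: "h_geodesic A B N c \<gamma>" and hor: "\<forall>t\<in>{0..1}. snd (\<gamma> t) = xb"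
    and \<psi>: "\<psi> \<in> B" "xb \<in> fst \<psi>" and s: "s \<in> {0..1}" and \<phi>: "\<phi> \<in> A" "fst (\<gamma> s) \<in> fst \<phi>"
  shows "\<exists>v b. has_deriv2 (\<lambda>r. fibre_hessian \<psi> q \<rho> (snd \<psi> xb) (fst (\<gamma> r)))
      (\<lambda>r. cost_domain.slice_hessian_deriv (local_cost c \<phi> \<psi>) q \<rho> (dsum (snd \<phi> (fst (\<gamma> r))) (snd \<psi> xb)) (v r)) b s \<and> b \<le> 0"
proof -
  interpret cost_domain "local_cost c \<phi> \<psi>" "domain \<phi> \<psi>" by (rule cost_domain[OF \<phi>(1) \<psi>(1)])
  define \<zeta> where "\<zeta> r = snd \<phi> (fst (\<gamma> r))" for r
  define w where "w = snd \<psi> xb"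
  note cont = h_geodesicD(1)[OF geo] and inN = h_geodesicD(2)[OF geo]
  obtain v where v: "\<forall>t\<in>{0..1}. \<gamma> t \<in> fst \<phi> \<times> fst \<psi> \<longrightarrow>
      ((\<lambda>s. coords \<phi> \<psi> (\<gamma> s)) has_vector_derivative v t) (at t within {0..1}) \<and>
      (v has_vector_derivative (\<chi> k. - (\<Sum>i\<in>UNIV. \<Sum>j\<in>UNIV. \<Gamma> k i j (coords \<phi> \<psi> (\<gamma> t)) * v t $ i * v t $ j)))
        (at t within {0..1})"
    by (rule exE[OF h_geodesicD(3)[OF geo \<phi>(1) \<psi>(1)]])
  note velocity = v[THEN bspec, THEN mp, THEN conjunct1] and acceleration = v[THEN bspec, THEN mp, THEN conjunct2]
  have coords: "coords \<phi> \<psi> (\<gamma> r) = dsum (\<zeta> r) w" if "r \<in> {0..1}" for r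
    using hor[rule_format, OF that] by (simp add: coords_def \<zeta>_def w_def)
  have s_in: "\<gamma> s \<in> fst \<phi> \<times> fst \<psi>" using hor[rule_format, OF s] \<phi> \<psi> by (simp add: mem_Times_iff)
  have near: "\<forall>\<^sub>F r in nhds s. r \<in> {0..1} \<longrightarrow> \<gamma> r \<in> fst \<phi> \<times> fst \<psi>"
    using charts(1)[OF \<phi>(1)] charts(2)[OF \<psi>(1)]
    by (intro curve_eventually_in_open[OF cont s _ s_in] open_Times) (auto simp: is_chart_def)
  \<comment> \<open>The horizontal part of the full geodesic acceleration;
    \<open>christoffel_quadratic\<close> reduces it to the Christoffel symbols of the first
    factor.\<close>
  define a where "a = pr1 (\<chi> k. - (\<Sum>i\<in>UNIV. \<Sum>j\<in>UNIV. \<Gamma> k i j (coords \<phi> \<psi> (\<gamma> s)) * v s $ i * v s $ j))"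
  have vel: "\<forall>\<^sub>F r in nhds s. r \<in> {0..1} \<longrightarrow> dsum (\<zeta> r) w \<in> domain \<phi> \<psi> \<and>
      (\<zeta> has_vector_derivative pr1 (v r)) (at r within {0..1})"
    using near
  proof eventually_elim
    case (elim r)
    show ?case
    proof
      assume r: "r \<in> {0..1}"
      have "((\<lambda>s. pr1 (coords \<phi> \<psi> (\<gamma> s))) has_vector_derivative pr1 (v r)) (at r within {0..1})"
        by (rule bounded_linear.has_vector_derivative[OF bounded_linear_pr1 velocity[OF r elim[rule_format, OF r]]])
      moreover have "coords \<phi> \<psi> (\<gamma> r) \<in> domain \<phi> \<psi>"
        by (rule imageI) (rule IntI[OF inN[OF r] elim[rule_format, OF r]])
      moreover have "(\<lambda>s. pr1 (coords \<phi> \<psi> (\<gamma> s))) = \<zeta>"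
        by (rule ext) (simp add: coords_def \<zeta>_def)
      ultimately show "dsum (\<zeta> r) w \<in> domain \<phi> \<psi> \<and> (\<zeta> has_vector_derivative pr1 (v r)) (at r within {0..1})"
        unfolding coords[OF r] by simp
    qed
  qed
  have zs: "dsum (\<zeta> s) w \<in> domain \<phi> \<psi>" using eventually_nhds_x_imp_x[OF vel] s by blast
  have acc: "((\<lambda>r. pr1 (v r)) has_vector_derivative a) (at s within {0..1})"
    unfolding a_def by (rule bounded_linear.has_vector_derivative[OF bounded_linear_pr1 acceleration[OF s s_in]])
  have a: "a $ m = - (\<Sum>i\<in>UNIV. \<Sum>j\<in>UNIV. \<Gamma> (Inl m) (Inl i) (Inl j) (dsum (\<zeta> s) w) * pr1 (v s) $ i * pr1 (v s) $ j)" for m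
    unfolding a_def coords[OF s] christoffel_quadratic(1)[OF zs, symmetric] by (simp add: pr1_def)
  let ?b = "\<Sum>k\<in>UNIV. \<Sum>l\<in>UNIV. (q $ k * q $ l) *
      (\<Sum>i\<in>UNIV. \<Sum>j\<in>UNIV. cross_tensor i j k l (dsum (\<zeta> s) w) * pr1 (v s) $ i * pr1 (v s) $ j)"
  have "has_deriv2 (\<lambda>r. fibre_hessian \<psi> q \<rho> w (fst (\<gamma> r))) (\<lambda>r. slice_hessian_deriv q \<rho> (dsum (\<zeta> r) w) (pr1 (v r))) ?b s"
  proof (rule has_deriv2_cong[OF has_deriv2_slice_hessian[OF s vel acc a]])
    show "\<forall>\<^sub>F r in nhds s. r \<in> {0..1} \<longrightarrow> slice_hessian q \<rho> (dsum (\<zeta> r) w) = fibre_hessian \<psi> q \<rho> w (fst (\<gamma> r))"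
      using near
    proof eventually_elim
      case (elim r)
      show ?case
      proof
        assume r: "r \<in> {0..1}"
        have "(fst (\<gamma> r), xb) \<in> N" using inN[OF r] hor[rule_format, OF r] by (metis prod.collapse)
        then show "slice_hessian q \<rho> (dsum (\<zeta> r) w) = fibre_hessian \<psi> q \<rho> w (fst (\<gamma> r))"
          using slice_hessian_eq_fibre_hessian[OF \<phi>(1) _ \<psi>, of "fst (\<gamma> r)" q \<rho>] elim r
          by (auto simp: \<zeta>_def w_def mem_Times_iff)
      qed
    qed
  qed
  moreover have "0 \<le> cross_curvature c \<phi> \<psi> (\<gamma> s) (pr1 (v s)) q"
    using nonneg_cross[unfolded nonneg_cross_curved_def, THEN bspec, THEN bspec, THEN bspec,
        OF \<phi>(1) \<psi>(1) IntI[OF inN[OF s] s_in]] by blast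
  then have "?b \<le> 0"
    unfolding cross_curvature_def coords[OF s] curvature_operator_cross[OF zs] by simp
  ultimately show ?thesis
    unfolding \<zeta>_def[symmetric] w_def[symmetric]
    by (intro exI[of _ "\<lambda>r. pr1 (v r)"] exI[of _ ?b] conjI)
qed

text \<open>The vectors \<open>q\<close> and \<open>\<rho>\<close> are the velocity and acceleration
  of \<open>xb\<close> at \<open>t\<close> in the chart \<open>\<psi>\<close>. They are fixed before
  \<open>y\<close> is chosen, so the second derivatives for all \<open>y\<close> are values of one
  function. The geodesic equation at \<open>x\<close> gives the vanishing for every
  \<open>v\<close>, whatever initial velocity a horizontal geodesic from \<open>x\<close>
  has.\<close>

lemma vertical_geodesic:
  assumes geo: "h_geodesic A B N c (\<lambda>t. (x, xb t))" and t: "t \<in> {0..1}"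
    and \<phi>: "\<phi> \<in> A" "x \<in> fst \<phi>" and \<psi>: "\<psi> \<in> B" "xb t \<in> fst \<psi>"
  obtains q \<rho> where
    "\<forall>v. cost_domain.slice_hessian_deriv (local_cost c \<phi> \<psi>) q \<rho> (dsum (snd \<phi> x) (snd \<psi> (xb t))) v = 0"
    "\<forall>y. (\<forall>r\<in>{0..1}. (y, xb r) \<in> N) \<longrightarrow>
      (\<exists>f'. has_deriv2 (\<lambda>r. c (y, xb r)) f' (fibre_hessian \<psi> q \<rho> (snd \<psi> (xb t)) y) t)"
proof -
  interpret cost_domain "local_cost c \<phi> \<psi>" "domain \<phi> \<psi>" by (rule cost_domain[OF \<phi>(1) \<psi>(1)])
  define \<zeta> where "\<zeta> r = snd \<psi> (xb r)" for r
  note inN = h_geodesicD(2)[OF geo]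
  from continuous_on_snd[OF h_geodesicD(1)[OF geo]] have cont: "continuous_on {0..1} xb" by simp
  obtain v where v: "\<forall>t\<in>{0..1}. (x, xb t) \<in> fst \<phi> \<times> fst \<psi> \<longrightarrow>
      ((\<lambda>s. coords \<phi> \<psi> (x, xb s)) has_vector_derivative v t) (at t within {0..1}) \<and>
      (v has_vector_derivative (\<chi> k. - (\<Sum>i\<in>UNIV. \<Sum>j\<in>UNIV. \<Gamma> k i j (coords \<phi> \<psi> (x, xb t)) * v t $ i * v t $ j)))
        (at t within {0..1})"
    by (rule exE[OF h_geodesicD(3)[OF geo \<phi>(1) \<psi>(1)]])
  note velocity = v[THEN bspec, THEN mp, THEN conjunct1] and acceleration = v[THEN bspec, THEN mp, THEN conjunct2]
  have near: "\<forall>\<^sub>F r in nhds t. r \<in> {0..1} \<longrightarrow> xb r \<in> fst \<psi>"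
    using charts(2)[OF \<psi>(1)] by (intro curve_eventually_in_open[OF cont t _ \<psi>(2)]) (auto simp: is_chart_def)
  define \<rho> where "\<rho> = pr2 (\<chi> k. - (\<Sum>i\<in>UNIV. \<Sum>j\<in>UNIV. \<Gamma> k i j (coords \<phi> \<psi> (x, xb t)) * v t $ i * v t $ j))"
  have zt: "dsum (snd \<phi> x) (snd \<psi> (xb t)) \<in> domain \<phi> \<psi>"
    using imageI[of "(x, xb t)" "N \<inter> fst \<phi> \<times> fst \<psi>" "coords \<phi> \<psi>"] inN[OF t] \<phi> \<psi> by (simp add: coords_def)
  have acc: "((\<lambda>r. pr2 (v r)) has_vector_derivative \<rho>) (at t within {0..1})"
    unfolding \<rho>_def using \<phi>(2) \<psi>(2)
    by (intro bounded_linear.has_vector_derivative[OF bounded_linear_pr2 acceleration[OF t]]) simp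
  show thesis
  proof (rule that[of "pr2 (v t)" \<rho>]; intro allI impI)
    fix v'
    have "\<rho> $ k = - (\<Sum>i\<in>UNIV. \<Sum>j\<in>UNIV. \<Gamma> (Inr k) (Inr i) (Inr j) (dsum (snd \<phi> x) (snd \<psi> (xb t)))
        * pr2 (v t) $ i * pr2 (v t) $ j)" for k
      unfolding \<rho>_def coords_def fst_conv snd_conv christoffel_quadratic(2)[OF zt, symmetric] by (simp add: pr2_def)
    then show "slice_hessian_deriv (pr2 (v t)) \<rho> (dsum (snd \<phi> x) (snd \<psi> (xb t))) v' = 0"
      by (rule slice_hessian_deriv_geodesic[OF zt])
  next
    fix y assume "\<forall>r\<in>{0..1}. (y, xb r) \<in> N"
    then have y: "\<And>r. r \<in> {0..1} \<Longrightarrow> (y, xb r) \<in> N" by (rule bspec)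
    \<comment> \<open>Only the chart around \<open>y\<close> is replaced; keeping
      \<open>\<psi>\<close> preserves the meaning of \<open>q\<close> and
      \<open>\<rho>\<close>.\<close>
    obtain \<phi>' \<psi>' where \<phi>': "\<phi>' \<in> A" "y \<in> fst \<phi>'" "\<psi>' \<in> B" "xb t \<in> fst \<psi>'" by (rule obtain_charts)
    interpret y: cost_domain "local_cost c \<phi>' \<psi>" "domain \<phi>' \<psi>" by (rule cost_domain[OF \<phi>'(1) \<psi>(1)])
    have vel: "\<forall>\<^sub>F r in nhds t. r \<in> {0..1} \<longrightarrow> dsum (snd \<phi>' y) (\<zeta> r) \<in> domain \<phi>' \<psi> \<and>
        (\<zeta> has_vector_derivative pr2 (v r)) (at r within {0..1})"
      using near
    proof eventually_elim
      case (elim r)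
      show ?case
      proof
        assume r: "r \<in> {0..1}"
        have "((\<lambda>s. pr2 (coords \<phi> \<psi> (x, xb s))) has_vector_derivative pr2 (v r)) (at r within {0..1})"
          using elim r \<phi>(2)
          by (intro bounded_linear.has_vector_derivative[OF bounded_linear_pr2 velocity[OF r]]) simp
        moreover have "(\<lambda>s. pr2 (coords \<phi> \<psi> (x, xb s))) = \<zeta>"
          by (rule ext) (simp add: coords_def \<zeta>_def)
        moreover have "coords \<phi>' \<psi> (y, xb r) \<in> domain \<phi>' \<psi>"
          by (rule imageI) (use elim r y \<phi>'(2) in simp)
        then have "dsum (snd \<phi>' y) (\<zeta> r) \<in> domain \<phi>' \<psi>" unfolding coords_def \<zeta>_def by simp
        ultimately show "dsum (snd \<phi>' y) (\<zeta> r) \<in> domain \<phi>' \<psi> \<and> (\<zeta> has_vector_derivative pr2 (v r)) (at r within {0..1})"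
          by simp
      qed
    qed
    obtain f' where f': "has_deriv2 (\<lambda>r. local_cost c \<phi>' \<psi> (dsum (snd \<phi>' y) (\<zeta> r))) f'
        (y.slice_hessian (pr2 (v t)) \<rho> (dsum (snd \<phi>' y) (\<zeta> t))) t"
      by (rule exE[OF y.has_deriv2_vertical[OF t vel acc]])
    have fibre: "y.slice_hessian (pr2 (v t)) \<rho> (dsum (snd \<phi>' y) (\<zeta> t))
        = fibre_hessian \<psi> (pr2 (v t)) \<rho> (snd \<psi> (xb t)) y"
      unfolding \<zeta>_def by (rule slice_hessian_eq_fibre_hessian[OF \<phi>'(1,2) \<psi> y[OF t]])
    have local: "\<forall>\<^sub>F r in nhds t. r \<in> {0..1} \<longrightarrow> local_cost c \<phi>' \<psi> (dsum (snd \<phi>' y) (\<zeta> r)) = c (y, xb r)"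
      using near
      by eventually_elim (simp add: local_cost_def \<zeta>_def chart_inv_left[OF charts(1)[OF \<phi>'(1)] \<phi>'(2)]
        chart_inv_left[OF charts(2)[OF \<psi>(1)]])
    show "\<exists>f'. has_deriv2 (\<lambda>r. c (y, xb r)) f' (fibre_hessian \<psi> (pr2 (v t)) \<rho> (snd \<psi> (xb t)) y) t"
      using has_deriv2_cong[OF f' local] unfolding fibre by (rule exI[of _ f'])
  qed
qed

section \<open>Convexity in the parameter of the vertical geodesic\<close>

lemma second_derivative_nonneg:
  assumes geo: "h_geodesic A B N c (\<lambda>t. (x, xb t))" and t: "t \<in> {0..1}"
    and y: "y \<in> (\<Inter>t\<in>{0..1}. illuminated A B N c x (xb t))"
  shows "\<exists>f' b. has_deriv2 (\<lambda>r. - c (y, xb r) + c (x, xb r)) f' b t \<and> 0 \<le> b"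
proof -
  obtain \<phi> \<psi> where \<phi>: "\<phi> \<in> A" "x \<in> fst \<phi>" and \<psi>: "\<psi> \<in> B" "xb t \<in> fst \<psi>" by (rule obtain_charts)
  obtain q \<rho> where zero: "\<forall>v. cost_domain.slice_hessian_deriv (local_cost c \<phi> \<psi>) q \<rho> (dsum (snd \<phi> x) (snd \<psi> (xb t))) v = 0"
    and vert: "\<forall>y. (\<forall>r\<in>{0..1}. (y, xb r) \<in> N) \<longrightarrow>
      (\<exists>f'. has_deriv2 (\<lambda>r. c (y, xb r)) f' (fibre_hessian \<psi> q \<rho> (snd \<psi> (xb t)) y) t)"
    by (rule vertical_geodesic[OF geo t \<phi> \<psi>])
  define G where "G = fibre_hessian \<psi> q \<rho> (snd \<psi> (xb t))"
  obtain \<gamma> where \<gamma>: "h_geodesic A B N c \<gamma>" "\<gamma> 0 = (x, xb t)" "\<gamma> 1 = (y, xb t)"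
    "\<forall>s\<in>{0..1}. snd (\<gamma> s) = xb t"
  proof -
    have "y \<in> illuminated A B N c x (xb t)" using y t by blast
    then show thesis using that unfolding illuminated_def mem_Times_iff by blast
  qed
  define g where "g s = - 1 * G (fst (\<gamma> s))" for s
  have "\<exists>a b. has_deriv2 g a b s \<and> 0 \<le> b" if s: "s \<in> {0..1}" for s
  proof -
    \<comment> \<open>A new chart of the first factor for each \<open>s\<close>, with
      \<open>\<psi>\<close> and hence \<open>G\<close> unchanged.\<close>
    obtain \<phi>' \<psi>' where \<phi>': "\<phi>' \<in> A" "fst (\<gamma> s) \<in> fst \<phi>'" "\<psi>' \<in> B" "xb t \<in> fst \<psi>'" by (rule obtain_charts)
    obtain v b where vb: "has_deriv2 (\<lambda>r. G (fst (\<gamma> r)))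
      (\<lambda>r. cost_domain.slice_hessian_deriv (local_cost c \<phi>' \<psi>) q \<rho> (dsum (snd \<phi>' (fst (\<gamma> r))) (snd \<psi> (xb t))) (v r)) b s
      \<and> b \<le> 0"
      using horizontal_geodesic[OF \<gamma>(1,4) \<psi> s \<phi>'(1,2), of q \<rho>] unfolding G_def[symmetric] by (elim exE) (rule that)
    from vb have "0 \<le> - 1 * b" by simp
    with has_deriv2_cmult[OF conjunct1[OF vb], of "- 1"] show ?thesis
      unfolding g_def[abs_def] by (intro exI conjI)
  qed
  then obtain a where der: "\<And>s. s \<in> {0..1} \<Longrightarrow> (g has_real_derivative a s) (at s within {0..1})"
    and mono: "\<And>s t. 0 \<le> s \<Longrightarrow> s \<le> t \<Longrightarrow> t \<le> 1 \<Longrightarrow> a s \<le> a t"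
    using has_deriv2_nonneg_imp_mono_deriv by blast
  have zero_in: "0 \<in> {0..1::real}" by simp
  have x0: "fst (\<gamma> 0) \<in> fst \<phi>" using \<gamma>(2) \<phi> by simp
  \<comment> \<open>At the starting point the computation is repeated in the chart
    \<open>\<phi>\<close>, the one for which \<open>zero\<close> is known.\<close>
  obtain v b where vb: "has_deriv2 (\<lambda>r. G (fst (\<gamma> r)))
      (\<lambda>r. cost_domain.slice_hessian_deriv (local_cost c \<phi> \<psi>) q \<rho> (dsum (snd \<phi> (fst (\<gamma> r))) (snd \<psi> (xb t))) (v r)) b 0 \<and> b \<le> 0"
    using horizontal_geodesic[OF \<gamma>(1,4) \<psi> zero_in \<phi>(1) x0, of q \<rho>] unfolding G_def[symmetric] by (elim exE) (rule that)
  have "0 \<in> {0..1::real} \<longrightarrow> ((\<lambda>r. G (fst (\<gamma> r))) has_real_derivative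
      cost_domain.slice_hessian_deriv (local_cost c \<phi> \<psi>) q \<rho> (dsum (snd \<phi> (fst (\<gamma> 0))) (snd \<psi> (xb t))) (v 0))
        (at 0 within {0..1})"
    by (rule eventually_nhds_x_imp_x[OF vb[THEN conjunct1, unfolded has_deriv2_def, THEN conjunct1]])
  then have "((\<lambda>r. G (fst (\<gamma> r))) has_real_derivative 0) (at 0 within {0..1})"
    by (simp add: \<gamma>(2) zero)
  from DERIV_cmult[OF this, of "- 1"]
  have "(g has_real_derivative 0) (at 0 within {0..1})"
    by (simp add: g_def[abs_def])
  \<comment> \<open>The abstract derivative \<open>a\<close> and the one computed in
    \<open>\<phi>\<close> agree at the endpoint by uniqueness of one-sided derivatives.\<close>
  then have "a 0 = 0"
    using der[of 0] vector_derivative_within_cbox[of 0 1 0 g 0] vector_derivative_within_cbox[of 0 1 0 g "a 0"]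
    by (simp add: has_real_derivative_iff_has_vector_derivative)
  then have "g 0 \<le> g 1" using mono_deriv_tangent[OF der mono] by simp
  then have le: "0 \<le> - 1 * G y + G x" using \<gamma>(2,3) by (simp add: g_def)
  have xN: "(x, xb r) \<in> N" if "r \<in> {0..1}" for r
    by (rule h_geodesicD(2)[OF geo that])
  have yN: "(y, xb r) \<in> N" if "r \<in> {0..1}" for r
    using y that by (auto simp: illuminated_def visible_def)
  obtain fy where fy: "has_deriv2 (\<lambda>r. c (y, xb r)) fy (G y) t"
    using vert yN unfolding G_def by blast
  obtain fx where fx: "has_deriv2 (\<lambda>r. c (x, xb r)) fx (G x) t"
    using vert xN unfolding G_def by blast
  have "has_deriv2 (\<lambda>r. - c (y, xb r) + c (x, xb r)) (\<lambda>r. - 1 * fy r + fx r) (- 1 * G y + G x) t"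
    using has_deriv2_add[OF has_deriv2_cmult[OF fy, of "- 1"] fx] by simp
  with le show ?thesis by (intro exI conjI)
qed

lemma convex_on_illuminated:
  assumes geo: "h_geodesic A B N c (\<lambda>t. (x, xb t))" and t: "t \<in> {0..1}"
    and y: "y \<in> (\<Inter>t\<in>{0..1}. illuminated A B N c x (xb t))"
  shows "- c (y, xb t) + c (x, xb t) \<le> (1 - t) * (- c (y, xb 0) + c (x, xb 0)) + t * (- c (y, xb 1) + c (x, xb 1))"
proof -
  define f where "f r = - c (y, xb r) + c (x, xb r)" for r
  have "\<exists>f' b. has_deriv2 f f' b s \<and> 0 \<le> b" if "s \<in> {0..1}" for s
    using second_derivative_nonneg[OF geo that y] by (simp add: f_def[abs_def])
  then obtain a where "\<And>s. s \<in> {0..1} \<Longrightarrow> (f has_real_derivative a s) (at s within {0..1})"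
    "\<And>s t. 0 \<le> s \<Longrightarrow> s \<le> t \<Longrightarrow> t \<le> 1 \<Longrightarrow> a s \<le> a t"
    using has_deriv2_nonneg_imp_mono_deriv by blast
  from mono_deriv_chord[OF this t] show ?thesis by (simp add: f_def)
qed

end

theorem corollary2p11:
  fixes A :: "('a::{t2_space,second_countable_topology}, 'n::finite) chart set"
    and B :: "('b::{t2_space,second_countable_topology}, 'n) chart set"
    and N :: "('a \<times> 'b) set"
    and c :: "'a \<times> 'b \<Rightarrow> real"
    and x :: 'a
    and xb :: "real \<Rightarrow> 'b"
  assumes "smooth_atlas A" and "smooth_atlas B"
    and "open N"
    and "Ck_cost_on 4 A B N c" and "continuous_on UNIV c"
    and "bi_twisted A B N c"
    and "non_degenerate A B N c"
    and "nonneg_cross_curved A B N c"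
    and "h_geodesic A B N c (\<lambda>t. (x, xb t))"
    and "closure (\<Inter>t\<in>{0..1}. illuminated A B N c x (xb t)) = UNIV"
  shows "let f = (\<lambda>t y. - c (y, xb t) + c (x, xb t))
         in \<forall>y. \<forall>t\<in>{0..1}. f t y \<le> (1 - t) * f 0 y + t * f 1 y"
proof -
  interpret cross_curved_cost A B N c by unfold_locales fact+
  have "- c (y, xb t) + c (x, xb t) \<le> (1 - t) * (- c (y, xb 0) + c (x, xb 0)) + t * (- c (y, xb 1) + c (x, xb 1))"
    if t: "t \<in> {0..1}" for y t
  proof -
    let ?C = "{y. - c (y, xb t) + c (x, xb t) \<le> (1 - t) * (- c (y, xb 0) + c (x, xb 0)) + t * (- c (y, xb 1) + c (x, xb 1))}"
    \<comment> \<open>A limit point \<open>y\<close> may lie outside the visible sets, where nothing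
      is known about derivatives of \<open>c\<close>; continuity of \<open>c\<close> on the whole
      product is what makes the inequality closed in \<open>y\<close>.\<close>
    have "continuous_on UNIV (\<lambda>y. c (y, xb s))" for s
      by (rule continuous_on_compose2[OF assms(5)]) (auto intro!: continuous_intros)
    then have "closed ?C" by (intro closed_Collect_le continuous_intros)
    moreover have "(\<Inter>t\<in>{0..1}. illuminated A B N c x (xb t)) \<subseteq> ?C"
      using convex_on_illuminated[OF assms(9) t] by blast
    ultimately have "closure (\<Inter>t\<in>{0..1}. illuminated A B N c x (xb t)) \<subseteq> ?C" by (rule closure_minimal[rotated])
    then show ?thesis unfolding assms(10) by blast
  qed
  then show ?thesis by (simp add: Let_def)
qed

end
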